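(* Let $n\ge1$, let $\delta_1,\dots,\delta_n\in\mathbb D$, and for $1\le k\le n$ let $G_k\in\mathbb C^{(n+1)\times(n+1)}$ be the unitary matrix $$G_k=\begin{bmatrix}I_{k-1}&0&0\\0&\tilde G_k&0\\0&0&I_{n-k}\end{bmatrix},\qquad \tilde G_k=\begin{bmatrix}-\delta_k&\eta_k\\ \eta_k&\overline{\delta_k}\end{bmatrix},\qquad \eta_k=\sqrt{1-|\delta_k|^2}.$$ Let $\pi=(\pi_1,\dots,\pi_n)$ be a permutation of $(1,\dots,n)$ and $M_\pi=\prod_{k\in\pi}G_k=G_{\pi_1}\cdots G_{\pi_n}$. Let $A$ be a diagonal matrix of size $n+1$ with all entries in $\mathbb D$, and let $R_\pi$ be the unitary matrix $$R_\pi=\eta_A^{-1}(A+M_\pi)(A^*M_\pi+I)^{-1}\eta_A,\qquad \eta_A=(I-A^*A)^{1/2},$$ with eigenvalue decomposition $R_\pi=V_\pi\Lambda_\pi V_\pi^*$, where $V_\pi$ is the unitary matrix whose columns are the eigenvectors. Then $\Lambda_\pi$ (with the eigenvalues listed in a fixed order) and the absolute values of all the entries of $V_\pi$ are independent of $\pi$.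
   Context: $\mathbb D$ is the open unit disk; $I_m$ is the $m\times m$ identity matrix ($I_0$ empty) and $I$ the identity of size $n+1$; $^*$ denotes conjugate transpose. $\Lambda_\pi$ is diagonal. *)

theory Defs
  imports
    "Jordan_Normal_Form.Schur_Decomposition"
    "Jordan_Normal_Form.Gauss_Jordan_Elimination"
    "HOL-Combinatorics.Multiset_Permutations"
begin

definition unitary_mat :: "nat \<Rightarrow> complex mat \<Rightarrow> bool" where
  "unitary_mat m U \<longleftrightarrow> U \<in> carrier_mat m m \<and>
     mat_adjoint U * U = 1\<^sub>m m \<and> U * mat_adjoint U = 1\<^sub>m m"

definition psd_mat :: "nat \<Rightarrow> complex mat \<Rightarrow> bool" where
  "psd_mat m S \<longleftrightarrow> S \<in> carrier_mat m m \<and> mat_adjoint S = S \<and>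
     (\<forall>v\<in>carrier_vec m. 0 \<le> Re ((S *\<^sub>v v) \<bullet>c v))"

text \<open>The principal square root \<open>X\<^sup>1\<^sup>/\<^sup>2\<close>; meaningful when \<open>X\<close> is positive semidefinite,
  since then exactly one positive semidefinite square root exists.\<close>

definition sqrt_mat :: "complex mat \<Rightarrow> complex mat" where
  "sqrt_mat X = (THE S. psd_mat (dim_row X) S \<and> S * S = X)"

text \<open>Meaningful for invertible matrices only; otherwise \<open>mat_inverse\<close> returns \<open>None\<close>.\<close>

definition inv_mat :: "complex mat \<Rightarrow> complex mat" where
  "inv_mat X = the (mat_inverse X)"

definition Gtilde :: "complex \<Rightarrow> complex mat" where
  "Gtilde d = (let \<eta> = complex_of_real (sqrt (1 - (cmod d)\<^sup>2))
     in mat_of_rows_list 2 [[- d, \<eta>], [\<eta>, cnj d]])"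

definition G_mat :: "nat \<Rightarrow> (nat \<Rightarrow> complex) \<Rightarrow> nat \<Rightarrow> complex mat" where
  "G_mat n \<delta> k = diag_block_mat [1\<^sub>m (k - 1), Gtilde (\<delta> k), 1\<^sub>m (n - k)]"

text \<open>The list \<open>\<pi> = [\<pi>\<^sub>1, \<dots>, \<pi>\<^sub>n]\<close> gives the factors from left to right.\<close>

definition M_mat :: "nat \<Rightarrow> (nat \<Rightarrow> complex) \<Rightarrow> nat list \<Rightarrow> complex mat" where
  "M_mat n \<delta> \<pi> = foldr (*) (map (G_mat n \<delta>) \<pi>) (1\<^sub>m (n + 1))"

definition R_mat :: "nat \<Rightarrow> (nat \<Rightarrow> complex) \<Rightarrow> complex mat \<Rightarrow> nat list \<Rightarrow> complex mat" where
  "R_mat n \<delta> A \<pi> =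
     (let \<eta> = sqrt_mat (1\<^sub>m (n + 1) - mat_adjoint A * A); M = M_mat n \<delta> \<pi>
      in inv_mat \<eta> * (A + M) * inv_mat (mat_adjoint A * M + 1\<^sub>m (n + 1)) * \<eta>)"

text \<open>The total order \<open>r\<close> on the complex numbers fixes the order in which the eigenvalues
  (with multiplicity) are listed along the diagonal of \<open>\<Lambda>\<close>.\<close>

definition eigenvalue_decomposition ::
    "(complex \<times> complex) set \<Rightarrow> nat \<Rightarrow> complex mat \<Rightarrow> complex mat \<Rightarrow> complex mat \<Rightarrow> bool" where
  "eigenvalue_decomposition r m R V \<Lambda> \<longleftrightarrow>
     unitary_mat m V \<and> \<Lambda> \<in> carrier_mat m m \<and> diagonal_mat \<Lambda> \<and>
     R = V * \<Lambda> * mat_adjoint V \<and>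
     sorted_wrt (\<lambda>x y. (x, y) \<in> r) (diag_mat \<Lambda>)"

end

theory Submission
  imports Defs
begin

text \<open>
  Put \<open>D(\<mu>) = (I - \<mu> A\<^sup>*)\<^sup>-\<^sup>1 (\<mu> I - A)\<close>, a diagonal matrix that is unitary for
  \<open>|\<mu>| = 1\<close>. Substituting \<open>v = \<eta>\<^sub>A\<^sup>-\<^sup>1 (A\<^sup>* M + I) y\<close> turns the eigenvalue equation
  \<open>R v = \<mu> v\<close> into the twisted equation \<open>M y = D(\<mu>) y\<close>, and then \<open>v\<close> is \<open>y\<close> multiplied by
  an invertible diagonal matrix which depends on \<open>\<mu>\<close> but not on the order of the factors in
  \<open>M\<close>. It therefore suffices to understand the twisted equation.

  In a product of the \<open>G\<^sub>k\<close> in any order, the last rotation \<open>G\<^sub>n\<close> can be moved to the far left or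
  to the far right, because it commutes with every factor except \<open>G\<^sub>n\<^sub>-\<^sub>1\<close>
  (\<open>act_peel_last\<close>). Solving the first \<open>n\<close> rows of the twisted equation is thus an induction on
  \<open>n\<close>. In both positions the new rotation receives a component \<open>p\<close> and must return \<open>\<rho> p\<close>,
  where the unimodular number \<open>\<rho>\<close> is the same in the two cases. This fixes the phase of the last
  component and the ratio of the last two moduli by one step of the Schur algorithm
  (\<open>phase\<close>, \<open>profile\<close>), so neither depends on the order
  (\<open>act_twisted_eigenvector\<close>, \<open>act_twisted_eigenvector_exists\<close>). The remaining row says that
  this phase equals the last entry of \<open>D(\<mu>)\<close>, which is an equation for \<open>\<mu>\<close> without reference to
  the order (\<open>eigenvalue_iff_phase\<close>).

  The moduli of an eigenvector are therefore determined by \<open>\<mu>\<close> and the modulus of the first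
  component (\<open>eigenvector_profile\<close>). In particular the first component cannot vanish, so all
  eigenspaces are lines and the spectrum is simple. A sorted list of distinct eigenvalues is
  determined by its set, and a unit vector with prescribed ratios of moduli has prescribed moduli
  (\<open>eigenvalue_decomposition_determined\<close>). That a decomposition exists is the spectral theorem for
  unitary matrices (\<open>isometry_eigenvalue_decomposition\<close>).
\<close>

section \<open>Products of plane rotations acting on sequences\<close>

text \<open>
  The action of \<open>G\<^sub>k\<close> on the coordinates \<open>k - 1\<close> and \<open>k\<close> of a sequence indexed from \<open>0\<close>.
  Sequences carry no dimension, so the products for different \<open>n\<close> act on the same space and
  induction on \<open>n\<close> is possible.
\<close>

definition givens :: "(nat \<Rightarrow> complex) \<Rightarrow> nat \<Rightarrow> (nat \<Rightarrow> complex) \<Rightarrow> nat \<Rightarrow> complex" where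
  "givens \<delta> k y = (let \<eta> = complex_of_real (sqrt (1 - (cmod (\<delta> k))\<^sup>2)) in
     y(k - 1 := - \<delta> k * y (k - 1) + \<eta> * y k, k := \<eta> * y (k - 1) + cnj (\<delta> k) * y k))"

abbreviation act :: "(nat \<Rightarrow> complex) \<Rightarrow> nat list \<Rightarrow> (nat \<Rightarrow> complex) \<Rightarrow> nat \<Rightarrow> complex" where
  "act \<delta> \<pi> y \<equiv> foldr (givens \<delta>) \<pi> y"

lemma givens_commute:
  assumes "1 \<le> j" "j + 1 < k"
  shows "givens \<delta> j (givens \<delta> k y) = givens \<delta> k (givens \<delta> j y)"
proof -
  obtain a b where ab: "j = Suc a" "k = Suc b" using assms by (cases j; cases k) auto
  have neq: "a \<noteq> b" "a \<noteq> Suc b" "Suc a \<noteq> b" using assms ab by auto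
  show ?thesis unfolding ab using neq neq[symmetric]
    by (simp add: givens_def Let_def fun_upd_twist)
qed

lemma givens_act_commute:
  assumes "\<And>j. j \<in> set xs \<Longrightarrow> 1 \<le> j \<and> j + 1 < k"
  shows "act \<delta> xs (givens \<delta> k y) = givens \<delta> k (act \<delta> xs y)"
  using assms by (induction xs) (simp_all, intro givens_commute, auto)

text \<open>
  The rotation \<open>G\<^sub>m\<^sub>+\<^sub>1\<close> fails to commute only with \<open>G\<^sub>m\<close>. Hence it moves to the left end if
  \<open>G\<^sub>m\<close> stands to its right, and to the right end if \<open>G\<^sub>m\<close> stands to its left.
\<close>

lemma act_peel_last:
  assumes "distinct \<pi>" "set \<pi> = {1..Suc m}"
  obtains \<pi>' where "distinct \<pi>'" "set \<pi>' = {1..m}"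
    "(\<forall>y. act \<delta> \<pi> y = act \<delta> \<pi>' (givens \<delta> (Suc m) y)) \<or>
     (\<forall>y. act \<delta> \<pi> y = givens \<delta> (Suc m) (act \<delta> \<pi>' y))"
proof -
  have "Suc m \<in> set \<pi>" using assms by auto
  then obtain xs ys where \<pi>: "\<pi> = xs @ Suc m # ys" by (meson split_list)
  have dist: "distinct (xs @ ys)" using assms(1) unfolding \<pi> by auto
  have "set (xs @ ys) = set \<pi> - {Suc m}" using assms(1) unfolding \<pi> by auto
  also have "\<dots> = {1..m}" unfolding assms(2) by auto
  finally have set: "set (xs @ ys) = {1..m}" .
  have small: "1 \<le> j \<and> j + 1 < Suc m" if "j \<in> set (xs @ ys)" "j \<noteq> m" for j
  proof -
    have "j \<in> {1..m}" using that set by blast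
    then show ?thesis using that by auto
  qed
  show thesis
  proof (cases "m \<in> set xs")
    case False
    have "act \<delta> \<pi> y = givens \<delta> (Suc m) (act \<delta> (xs @ ys) y)" for y
    proof -
      have "act \<delta> xs (givens \<delta> (Suc m) (act \<delta> ys y)) = givens \<delta> (Suc m) (act \<delta> xs (act \<delta> ys y))"
        by (rule givens_act_commute, rule small) (use False in auto)
      then show ?thesis unfolding \<pi> by simp
    qed
    then show thesis using that[OF dist set] by blast
  next
    case True
    have "m \<notin> set ys" using True dist by auto
    have "act \<delta> \<pi> y = act \<delta> (xs @ ys) (givens \<delta> (Suc m) y)" for y
    proof -
      have "act \<delta> ys (givens \<delta> (Suc m) y) = givens \<delta> (Suc m) (act \<delta> ys y)"
        by (rule givens_act_commute, rule small) (use \<open>m \<notin> set ys\<close> in auto)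
      then show ?thesis unfolding \<pi> by simp
    qed
    then show thesis using that[OF dist set] by blast
  qed
qed

lemma act_above:
  assumes "set \<pi> \<subseteq> {1..m}" "m < i"
  shows "act \<delta> \<pi> y i = y i"
  using assms by (induction \<pi>) (auto simp: givens_def Let_def)

lemma givens_cong:
  assumes "\<And>j. j \<in> {i, k, k - 1} \<Longrightarrow> y j = y' j"
  shows "givens \<delta> k y i = givens \<delta> k y' i"
  using assms by (simp add: givens_def Let_def)

lemma act_cong_below:
  assumes "set \<pi> \<subseteq> {1..m}" "\<And>i. i \<le> m \<Longrightarrow> y i = y' i" "i \<le> m"
  shows "act \<delta> \<pi> y i = act \<delta> \<pi> y' i"
  using assms(1,3)
proof (induction \<pi> arbitrary: i)
  case (Cons k \<pi>)
  have "givens \<delta> k (act \<delta> \<pi> y) i = givens \<delta> k (act \<delta> \<pi> y') i"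
    using Cons.prems by (intro givens_cong Cons.IH) auto
  then show ?case by simp
qed (use assms(2) in auto)

text \<open>
  Each rotation is unitary because its two-dimensional block is.
\<close>

lemma sum_givens:
  assumes "1 \<le> k" "k \<le> n" "cmod (\<delta> k) < 1"
  shows "(\<Sum>i\<le>n. givens \<delta> k y i * cnj (givens \<delta> k y' i)) = (\<Sum>i\<le>n. y i * cnj (y' i))"
proof -
  obtain j where k: "k = Suc j" using assms(1) by (cases k) auto
  define e where "e = complex_of_real (sqrt (1 - (cmod (\<delta> k))\<^sup>2))"
  have e2: "e * e = 1 - \<delta> k * cnj (\<delta> k)" and e_cnj: "cnj e = e"
  proof -
    have "(cmod (\<delta> k))\<^sup>2 \<le> 1" using assms(3) by (simp add: abs_square_le_1)
    then show "e * e = 1 - \<delta> k * cnj (\<delta> k)"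
      unfolding e_def complex_norm_square[symmetric]
      by (simp flip: of_real_mult)
    show "cnj e = e" by (simp add: e_def)
  qed
  have set: "{..n} = insert j (insert k ({..n} - {j,k}))" using assms k by auto
  let ?g = "givens \<delta> k"
  have g: "?g z j = - \<delta> k * z j + e * z k" "?g z k = e * z j + cnj (\<delta> k) * z k" for z
    by (auto simp: givens_def Let_def e_def k)
  have "?g y j * cnj (?g y' j) + ?g y k * cnj (?g y' k)
      = (e * e + \<delta> k * cnj (\<delta> k)) * (y j * cnj (y' j) + y k * cnj (y' k))"
    unfolding g by (simp add: e_cnj algebra_simps)
  then have two: "?g y j * cnj (?g y' j) + ?g y k * cnj (?g y' k) = y j * cnj (y' j) + y k * cnj (y' k)"
    unfolding e2 by simp
  have rest: "(\<Sum>i\<in>{..n} - {j,k}. ?g y i * cnj (?g y' i)) = (\<Sum>i\<in>{..n} - {j,k}. y i * cnj (y' i))"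
    using k by (intro sum.cong) (auto simp: givens_def Let_def)
  have split: "(\<Sum>i\<le>n. f i) = f j + f k + (\<Sum>i\<in>{..n} - {j,k}. f i)" for f :: "nat \<Rightarrow> complex"
    by (subst set) (auto simp: k add.assoc)
  show ?thesis unfolding split two rest ..
qed

lemma sum_act:
  assumes "set \<pi> \<subseteq> {1..n}" "\<And>k. k \<in> {1..n} \<Longrightarrow> cmod (\<delta> k) < 1"
  shows "(\<Sum>i\<le>n. act \<delta> \<pi> y i * cnj (act \<delta> \<pi> y' i)) = (\<Sum>i\<le>n. y i * cnj (y' i))"
  using assms by (induction \<pi>) (auto simp: sum_givens)

section \<open>Twisted eigenvectors and the Schur recursion\<close>

text \<open>
  For a solution \<open>y\<close> of the first \<open>m\<close> rows of \<open>M y = D y\<close>, with \<open>D\<close> diagonal with entries \<open>d\<close>,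
  and \<open>M\<close> a product of the first \<open>m\<close> rotations, this is the factor by which \<open>M\<close> multiplies the component \<open>y\<^sub>m\<close>. The step is that of the Schur
  algorithm: \<open>\<rho> \<mapsto> (1 + \<delta>\<^sup>* \<rho>) / (\<rho> + \<delta>)\<close> sends the unit circle to itself.
\<close>

fun phase :: "(nat \<Rightarrow> complex) \<Rightarrow> (nat \<Rightarrow> complex) \<Rightarrow> nat \<Rightarrow> complex" where
  "phase \<delta> d 0 = 1"
| "phase \<delta> d (Suc m) =
     (let \<rho> = d m / phase \<delta> d m in (1 + cnj (\<delta> (Suc m)) * \<rho>) / (\<rho> + \<delta> (Suc m)))"

text \<open>
  The ratio \<open>|y\<^sub>m| / |y\<^sub>0|\<close> for the same solutions.
\<close>

fun profile :: "(nat \<Rightarrow> complex) \<Rightarrow> (nat \<Rightarrow> complex) \<Rightarrow> nat \<Rightarrow> real" where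
  "profile \<delta> d 0 = 1"
| "profile \<delta> d (Suc m) = profile \<delta> d m *
     cmod (d m / phase \<delta> d m + \<delta> (Suc m)) / sqrt (1 - (cmod (\<delta> (Suc m)))\<^sup>2)"

lemma add_unit_nonzero:
  assumes "cmod \<rho> = 1" "cmod \<delta> < 1"
  shows "\<rho> + \<delta> \<noteq> 0"
  using assms by (metis add_eq_0_iff norm_minus_cancel less_irrefl)

lemma norm_phase:
  assumes "\<And>k. k \<in> {1..m} \<Longrightarrow> cmod (\<delta> k) < 1" "\<And>i. i < m \<Longrightarrow> cmod (d i) = 1"
  shows "cmod (phase \<delta> d m) = 1"
  using assms
proof (induction m)
  case (Suc m)
  define \<rho> where "\<rho> = d m / phase \<delta> d m"
  define c where "c = \<delta> (Suc m)"
  have \<rho>: "cmod \<rho> = 1" using Suc by (simp add: \<rho>_def norm_divide)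
  then have inv: "\<rho> * cnj \<rho> = 1" by (simp add: complex_norm_square[symmetric])
  have "1 + cnj c * \<rho> = \<rho> * cnj (\<rho> + c)" using inv by (simp add: algebra_simps)
  moreover have "\<rho> + c \<noteq> 0" using \<rho> Suc.prems by (intro add_unit_nonzero) (auto simp: c_def)
  ultimately show ?case using \<rho>
    by (simp add: Let_def norm_divide norm_mult flip: \<rho>_def c_def complex_cnj_add)
qed auto

lemma profile_pos:
  assumes "\<And>k. k \<in> {1..m} \<Longrightarrow> cmod (\<delta> k) < 1" "\<And>i. i < m \<Longrightarrow> cmod (d i) = 1"
  shows "0 < profile \<delta> d m"
  using assms
proof (induction m)
  case (Suc m)
  have less: "cmod (\<delta> (Suc m)) < 1" using Suc.prems(1) by simp
  have "cmod (d m / phase \<delta> d m) = 1"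
    using norm_phase[of m \<delta> d] Suc.prems by (simp add: norm_divide)
  then have "d m / phase \<delta> d m + \<delta> (Suc m) \<noteq> 0" using less by (rule add_unit_nonzero)
  moreover have "(cmod (\<delta> (Suc m)))\<^sup>2 < 1" using less by (simp add: abs_square_less_1)
  moreover have "0 < profile \<delta> d m" using Suc.prems by (intro Suc.IH) simp_all
  ultimately show ?case by simp
qed simp

text \<open>
  If a rotation block maps \<open>(p, q)\<close> to a vector with first component \<open>\<rho> p\<close>, then the first row
  determines \<open>q\<close> from \<open>p\<close>, since \<open>\<eta> \<noteq> 0\<close>, and the second row then determines the
  factor on \<open>q\<close>.
\<close>

lemma givens_block:
  fixes \<delta> \<rho> p q :: complex
  defines "\<eta> \<equiv> complex_of_real (sqrt (1 - (cmod \<delta>)\<^sup>2))"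
  assumes "- \<delta> * p + \<eta> * q = \<rho> * p" "cmod \<rho> = 1" "cmod \<delta> < 1"
  shows "\<eta> * p + cnj \<delta> * q = (1 + cnj \<delta> * \<rho>) / (\<rho> + \<delta>) * q"
    and "cmod q = cmod (\<rho> + \<delta>) / sqrt (1 - (cmod \<delta>)\<^sup>2) * cmod p"
proof -
  have lt: "(cmod \<delta>)\<^sup>2 < 1" using assms(4) by (simp add: abs_square_less_1)
  then have e2: "\<eta> * \<eta> = 1 - \<delta> * cnj \<delta>"
    unfolding \<eta>_def complex_norm_square[symmetric] by (simp flip: of_real_mult)
  have e0: "\<eta> \<noteq> 0" using lt by (simp add: \<eta>_def)
  have nz: "\<rho> + \<delta> \<noteq> 0" using assms by (intro add_unit_nonzero)
  have eq: "\<eta> * q = (\<rho> + \<delta>) * p" using assms(2) by (simp add: algebra_simps)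
  have "\<eta> * ((\<rho> + \<delta>) * p) = \<eta> * \<eta> * q" unfolding eq[symmetric] by simp
  then have "(\<rho> + \<delta>) * (\<eta> * p + cnj \<delta> * q) = (1 + cnj \<delta> * \<rho>) * q"
    unfolding e2 by (simp add: algebra_simps)
  then show "\<eta> * p + cnj \<delta> * q = (1 + cnj \<delta> * \<rho>) / (\<rho> + \<delta>) * q"
    using nz by (simp add: field_simps)
  have "cmod \<eta> = sqrt (1 - (cmod \<delta>)\<^sup>2)" using lt by (simp add: \<eta>_def)
  then have "sqrt (1 - (cmod \<delta>)\<^sup>2) * cmod q = cmod (\<rho> + \<delta>) * cmod p"
    using arg_cong[OF eq, of cmod] by (simp add: norm_mult)
  then show "cmod q = cmod (\<rho> + \<delta>) / sqrt (1 - (cmod \<delta>)\<^sup>2) * cmod p"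
    using lt by (simp add: field_simps)
qed

text \<open>
  Uniqueness for the twisted equation. Write \<open>\<tau>\<close> for the phase at \<open>m\<close>. If the last rotation acts
  first, it must turn \<open>y\<^sub>m\<close> into \<open>(d\<^sub>m / \<tau>) y\<^sub>m\<close>, which the other factors then multiply by \<open>\<tau>\<close>;
  if it acts last, it receives \<open>\<tau> y\<^sub>m\<close> and must return \<open>d\<^sub>m y\<^sub>m\<close>. In both cases it multiplies a
  component of modulus \<open>|y\<^sub>m|\<close> by \<open>\<rho> = d\<^sub>m / \<tau>\<close>.
\<close>

lemma act_twisted_eigenvector:
  assumes "distinct \<pi>" "set \<pi> = {1..m}"
    and "\<And>k. k \<in> {1..m} \<Longrightarrow> cmod (\<delta> k) < 1" "\<And>i. i < m \<Longrightarrow> cmod (d i) = 1"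
    and "\<And>i. i < m \<Longrightarrow> act \<delta> \<pi> y i = d i * y i"
  shows "act \<delta> \<pi> y m = phase \<delta> d m * y m \<and> (\<forall>i\<le>m. cmod (y i) = profile \<delta> d i * cmod (y 0))"
  using assms
proof (induction m arbitrary: \<pi> y)
  case (Suc m)
  let ?g = "givens \<delta> (Suc m)"
  define \<tau> where "\<tau> = phase \<delta> d m"
  define \<rho> where "\<rho> = d m / \<tau>"
  define c where "c = \<delta> (Suc m)"
  define \<eta> where "\<eta> = complex_of_real (sqrt (1 - (cmod c)\<^sup>2))"
  have c: "cmod c < 1" using Suc.prems by (auto simp: c_def)
  have \<tau>: "cmod \<tau> = 1" using Suc.prems by (auto simp: \<tau>_def intro!: norm_phase)
  then have \<tau>0: "\<tau> \<noteq> 0" by auto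
  have \<rho>: "cmod \<rho> = 1" using Suc.prems \<tau> by (simp add: \<rho>_def norm_divide)
  have g: "?g z i = z i" if "i \<noteq> m" "i \<noteq> Suc m" for z i
    using that by (simp add: givens_def Let_def)
  have gm: "?g z m = - c * z m + \<eta> * z (Suc m)" "?g z (Suc m) = \<eta> * z m + cnj c * z (Suc m)" for z
    by (auto simp: givens_def Let_def c_def \<eta>_def)
  obtain \<pi>' where \<pi>': "distinct \<pi>'" "set \<pi>' = {1..m}"
    and or: "(\<forall>y. act \<delta> \<pi> y = act \<delta> \<pi>' (?g y)) \<or> (\<forall>y. act \<delta> \<pi> y = ?g (act \<delta> \<pi>' y))"
    using act_peel_last[OF Suc.prems(1,2)] by blast
  have smaller: "\<And>k. k \<in> {1..m} \<Longrightarrow> cmod (\<delta> k) < 1" "\<And>i. i < m \<Longrightarrow> cmod (d i) = 1"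
    using Suc.prems(3,4) by simp_all
  have eq: "act \<delta> \<pi> y i = d i * y i" if "i < Suc m" for i using Suc.prems(5) that .
  \<comment> \<open>\<open>p\<close> is the component that the last rotation multiplies by \<open>\<rho>\<close>: \<open>y\<^sub>m\<close> itself if
    the rotation acts first, and \<open>\<tau> y\<^sub>m\<close> if it acts last.\<close>
  obtain p where p: "cmod p = cmod (y m)" "- c * p + \<eta> * y (Suc m) = \<rho> * p"
    "act \<delta> \<pi> y (Suc m) = \<eta> * p + cnj c * y (Suc m)"
    "\<forall>i\<le>m. cmod (y i) = profile \<delta> d i * cmod (y 0)"
  proof (cases "\<forall>y. act \<delta> \<pi> y = act \<delta> \<pi>' (?g y)")
    case True
    define u where "u = ?g y"
    have act: "act \<delta> \<pi> y = act \<delta> \<pi>' u" using True by (simp add: u_def)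
    have ui: "u i = y i" if "i < m" for i using that by (simp add: u_def g)
    have "act \<delta> \<pi>' u i = d i * u i" if "i < m" for i
      using that eq[of i] ui[of i] by (simp add: act)
    with smaller have "act \<delta> \<pi>' u m = phase \<delta> d m * u m \<and> (\<forall>i\<le>m. cmod (u i) = profile \<delta> d i * cmod (u 0))"
      by (intro Suc.IH[OF \<pi>'])
    then have IH: "act \<delta> \<pi>' u m = \<tau> * u m" "\<forall>i\<le>m. cmod (u i) = profile \<delta> d i * cmod (u 0)"
      unfolding \<tau>_def by blast+
    have "\<tau> * u m = d m * y m" using IH(1) eq[of m] by (simp add: act)
    then have um: "u m = \<rho> * y m" using \<tau>0 by (simp add: \<rho>_def field_simps)
    then have norms: "cmod (u i) = cmod (y i)" if "i \<le> m" for i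
      using that ui[of i] \<rho> by (cases "i = m") (auto simp: norm_mult)
    have profile: "\<forall>i\<le>m. cmod (y i) = profile \<delta> d i * cmod (y 0)"
      using IH(2) norms by (metis le0)
    have "act \<delta> \<pi> y (Suc m) = u (Suc m)" unfolding act using \<pi>' by (intro act_above) auto
    then have "act \<delta> \<pi> y (Suc m) = \<eta> * y m + cnj c * y (Suc m)" unfolding u_def gm .
    moreover have "- c * y m + \<eta> * y (Suc m) = \<rho> * y m" using um unfolding u_def gm .
    ultimately show thesis using profile by (intro that[of "y m"] refl)
  next
    case False
    define u where "u = act \<delta> \<pi>' y"
    have act: "act \<delta> \<pi> y = ?g u"
      unfolding u_def by (rule spec[OF mp[OF or[unfolded disj_imp] False]])
    have ui: "u i = d i * y i" if "i < m" for i using that eq[of i] by (simp add: act g)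
    with smaller have "act \<delta> \<pi>' y m = phase \<delta> d m * y m \<and> (\<forall>i\<le>m. cmod (y i) = profile \<delta> d i * cmod (y 0))"
      unfolding u_def by (intro Suc.IH[OF \<pi>'])
    then have IH: "u m = \<tau> * y m" "\<forall>i\<le>m. cmod (y i) = profile \<delta> d i * cmod (y 0)"
      unfolding \<tau>_def u_def by blast+
    have um1: "u (Suc m) = y (Suc m)" unfolding u_def using \<pi>' by (intro act_above) auto
    have "\<rho> * u m = d m * y m" using IH(1) \<tau>0 by (simp add: \<rho>_def)
    also have "\<dots> = ?g u m" using eq[of m] by (simp add: act)
    finally have "- c * u m + \<eta> * y (Suc m) = \<rho> * u m" using gm(1)[of u] um1 by simp
    moreover have "act \<delta> \<pi> y (Suc m) = \<eta> * u m + cnj c * y (Suc m)"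
      unfolding act gm um1 ..
    moreover have "cmod (u m) = cmod (y m)" using IH(1) \<tau> by (simp add: norm_mult)
    ultimately show thesis using IH(2) by (intro that[of "u m"])
  qed
  note block = givens_block[OF p(2)[unfolded \<eta>_def] \<rho> c, folded \<eta>_def]
  have "act \<delta> \<pi> y (Suc m) = phase \<delta> d (Suc m) * y (Suc m)"
    using block(1) p(3) by (simp add: Let_def flip: \<tau>_def \<rho>_def c_def)
  moreover have "cmod (y (Suc m)) = profile \<delta> d (Suc m) * cmod (y 0)"
  proof -
    have "cmod p = profile \<delta> d m * cmod (y 0)" using p(1,4) by (metis order_refl)
    then show ?thesis unfolding block(2) by (simp flip: \<tau>_def \<rho>_def c_def)
  qed
  ultimately show ?case using p(4) by (metis le_Suc_eq)
qed auto

text \<open>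
  The first row of each rotation block can be solved for the new component, again because
  \<open>\<eta> \<noteq> 0\<close>; so the uniqueness argument can be run as a construction.
\<close>

lemma act_twisted_eigenvector_exists:
  assumes "distinct \<pi>" "set \<pi> = {1..m}"
    and "\<And>k. k \<in> {1..m} \<Longrightarrow> cmod (\<delta> k) < 1" "\<And>i. i < m \<Longrightarrow> cmod (d i) = 1"
  shows "\<exists>y. y 0 \<noteq> 0 \<and> (\<forall>i<m. act \<delta> \<pi> y i = d i * y i)"
  using assms
proof (induction m arbitrary: \<pi>)
  case 0
  then show ?case by (intro exI[of _ "\<lambda>_. 1"]) auto
next
  case (Suc m)
  let ?g = "givens \<delta> (Suc m)"
  define \<tau> where "\<tau> = phase \<delta> d m"
  define \<rho> where "\<rho> = d m / \<tau>"
  define c where "c = \<delta> (Suc m)"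
  define \<eta> where "\<eta> = complex_of_real (sqrt (1 - (cmod c)\<^sup>2))"
  have "(cmod c)\<^sup>2 < 1" using Suc.prems by (auto simp: c_def abs_square_less_1)
  then have \<eta>0: "\<eta> \<noteq> 0" by (simp add: \<eta>_def)
  have \<tau>: "cmod \<tau> = 1" using Suc.prems by (auto simp: \<tau>_def intro!: norm_phase)
  then have \<tau>0: "\<tau> \<noteq> 0" by auto
  have "cmod \<rho> = 1" using Suc.prems \<tau> by (simp add: \<rho>_def norm_divide)
  then have \<rho>0: "\<rho> \<noteq> 0" by auto
  \<comment> \<open>The new component that the first row of the block demands.\<close>
  have core: "- c * p + \<eta> * ((\<rho> + c) / \<eta> * p) = \<rho> * p" for p
    using \<eta>0 by (simp add: distrib_right)
  have g: "?g z i = z i" if "i \<noteq> m" "i \<noteq> Suc m" for z i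
    using that by (simp add: givens_def Let_def)
  have gm: "?g z m = - c * z m + \<eta> * z (Suc m)" for z
    by (auto simp: givens_def Let_def c_def \<eta>_def)
  obtain \<pi>' where \<pi>': "distinct \<pi>'" "set \<pi>' = {1..m}"
    and or: "(\<forall>y. act \<delta> \<pi> y = act \<delta> \<pi>' (?g y)) \<or> (\<forall>y. act \<delta> \<pi> y = ?g (act \<delta> \<pi>' y))"
    using act_peel_last[OF Suc.prems(1,2)] by blast
  have smaller: "\<And>k. k \<in> {1..m} \<Longrightarrow> cmod (\<delta> k) < 1" "\<And>i. i < m \<Longrightarrow> cmod (d i) = 1"
    using Suc.prems(3,4) by simp_all
  obtain u where u0: "u 0 \<noteq> 0" and u: "\<And>i. i < m \<Longrightarrow> act \<delta> \<pi>' u i = d i * u i"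
    using Suc.IH[OF \<pi>' smaller] by blast
  have um: "act \<delta> \<pi>' u m = \<tau> * u m"
    using act_twisted_eigenvector[OF \<pi>' smaller u] unfolding \<tau>_def by blast
  show ?case
  proof (cases "\<forall>y. act \<delta> \<pi> y = act \<delta> \<pi>' (?g y)")
    case True
    define y where "y = u(m := u m / \<rho>, Suc m := (\<rho> + c) / \<eta> * (u m / \<rho>))"
    have gy: "?g y i = u i" if "i \<le> m" for i
    proof (cases "i = m")
      case True
      have "?g y m = \<rho> * (u m / \<rho>)" unfolding gm using core[of "u m / \<rho>"] by (simp add: y_def)
      then show ?thesis using True \<rho>0 by simp
    next
      case False
      have "?g y i = y i" using that False by (intro g) auto
      then show ?thesis using that False by (simp add: y_def)
    qed
    have act: "act \<delta> \<pi> y = act \<delta> \<pi>' (?g y)" using True by (rule spec)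
    have below: "act \<delta> \<pi> y i = act \<delta> \<pi>' u i" if "i \<le> m" for i
      unfolding act by (rule act_cong_below[OF _ gy that]) (use \<pi>' in auto)
    have "act \<delta> \<pi> y i = d i * y i" if "i < Suc m" for i
    proof (cases "i = m")
      case True
      have "\<tau> * u m = d m * (u m / \<rho>)" using \<rho>0 \<tau>0 by (simp add: \<rho>_def)
      also have "u m / \<rho> = y m" by (simp add: y_def)
      finally show ?thesis unfolding True below[OF order_refl] um .
    next
      case False
      then have "i < m" using that by simp
      moreover have "y i = u i" using \<open>i < m\<close> by (simp add: y_def)
      ultimately show ?thesis using below[of i] u[of i] by simp
    qed
    moreover have "y 0 \<noteq> 0" using u0 \<rho>0 by (simp add: y_def)
    ultimately show ?thesis by (intro exI[of _ y] conjI allI impI)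
  next
    case False
    define y where "y = u(Suc m := (\<rho> + c) / \<eta> * (\<tau> * u m))"
    have below: "act \<delta> \<pi>' y i = act \<delta> \<pi>' u i" if "i \<le> m" for i
      using that \<pi>' by (intro act_cong_below[where m = m]) (auto simp: y_def)
    have above: "act \<delta> \<pi>' y (Suc m) = y (Suc m)" using \<pi>' by (intro act_above) auto
    have act: "act \<delta> \<pi> y = ?g (act \<delta> \<pi>' y)" by (rule spec[OF mp[OF or[unfolded disj_imp] False]])
    have "act \<delta> \<pi> y i = d i * y i" if "i < Suc m" for i
    proof (cases "i = m")
      case True
      have "act \<delta> \<pi> y m = \<rho> * (\<tau> * u m)"
        unfolding act gm above using below[of m] um core[of "\<tau> * u m"] by (simp add: y_def)
      then show ?thesis using True \<tau>0 by (simp add: y_def \<rho>_def)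
    next
      case False
      have "act \<delta> \<pi> y i = act \<delta> \<pi>' y i" unfolding act using that False by (intro g) auto
      moreover have "y i = u i" using that by (simp add: y_def)
      ultimately show ?thesis using that False u[of i] below[of i] by simp
    qed
    moreover have "y 0 \<noteq> 0" using u0 by (simp add: y_def)
    ultimately show ?thesis by (intro exI[of _ y] conjI allI impI)
  qed
qed

section \<open>Inner products and adjoints\<close>

lemma mat_adjoint_dim [simp]:
  "dim_row (mat_adjoint U) = dim_col U" "dim_col (mat_adjoint U) = dim_row U"
  by (auto simp: mat_adjoint_def)

lemma mat_adjoint_carrier:
  "U \<in> carrier_mat m n \<Longrightarrow> mat_adjoint U \<in> carrier_mat n m"
  using carrier_matD[of U m n] by (intro carrier_matI) simp_all

lemma mat_adjoint_index:
  fixes U :: "complex mat"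
  assumes "i < dim_col U" "j < dim_row U"
  shows "mat_adjoint U $$ (i, j) = cnj (U $$ (j, i))"
  using assms by (simp add: mat_adjoint_def mat_of_rows_index)

lemma mat_vec_index_sum:
  assumes "M \<in> carrier_mat m n" "v \<in> carrier_vec n" "i < m"
  shows "(M *\<^sub>v v) $ i = (\<Sum>j<n. M $$ (i, j) * v $ j)"
  using assms by (auto simp: scalar_prod_def lessThan_atLeast0 intro!: sum.cong)

lemma cscalar_prod_sum:
  fixes v w :: "complex vec"
  assumes "w \<in> carrier_vec m"
  shows "v \<bullet>c w = (\<Sum>i<m. v $ i * cnj (w $ i))"
  using assms by (auto simp: scalar_prod_def lessThan_atLeast0 intro!: sum.cong)

lemma cscalar_prod_self:
  fixes v :: "complex vec"
  assumes "v \<in> carrier_vec m"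
  shows "v \<bullet>c v = complex_of_real (\<Sum>i<m. (cmod (v $ i))\<^sup>2)"
  unfolding cscalar_prod_sum[OF assms] of_real_sum complex_norm_square ..

lemma cscalar_prod_smult:
  fixes v w :: "complex vec"
  assumes "v \<in> carrier_vec m" "w \<in> carrier_vec m"
  shows "(a \<cdot>\<^sub>v v) \<bullet>c (b \<cdot>\<^sub>v w) = a * cnj b * (v \<bullet>c w)"
  using assms by (simp add: cscalar_prod_sum[of _ m] sum_distrib_left algebra_simps)

lemma cscalar_prod_commute:
  fixes v w :: "complex vec"
  assumes "v \<in> carrier_vec m" "w \<in> carrier_vec m"
  shows "w \<bullet>c v = cnj (v \<bullet>c w)"
  using assms by (simp add: cscalar_prod_sum[of _ m] mult.commute)

lemma adjoint_mult_index:
  fixes U :: "complex mat"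
  assumes "U \<in> carrier_mat m m" "i < m" "j < m"
  shows "(mat_adjoint U * U) $$ (i, j) = col U j \<bullet>c col U i"
  using assms
  by (auto simp: scalar_prod_def mat_adjoint_index mult.commute intro!: sum.cong)

lemma unitary_mat_orthonormal_cols:
  assumes "U \<in> carrier_mat m m"
    and "\<And>i j. i < m \<Longrightarrow> j < m \<Longrightarrow> col U j \<bullet>c col U i = (if i = j then 1 else 0)"
  shows "unitary_mat m U"
proof -
  have "mat_adjoint U * U = 1\<^sub>m m"
    using assms by (intro eq_matI) (auto simp: adjoint_mult_index simp del: index_mult_mat(1))
  then show ?thesis
    using assms(1) mat_adjoint_carrier[OF assms(1)] mat_mult_left_right_inverse
    unfolding unitary_mat_def by blast
qed

lemma mult_unit_vec_col:
  fixes U :: "complex mat"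
  assumes "U \<in> carrier_mat k m" "j < m"
  shows "U *\<^sub>v unit_vec m j = col U j"
  using assms by (intro eq_vecI) auto

lemma mult_mat_zero_vec:
  fixes U :: "complex mat"
  assumes "U \<in> carrier_mat k m"
  shows "U *\<^sub>v 0\<^sub>v m = 0\<^sub>v k"
  using assms by (intro eq_vecI) auto

lemma unitary_mat_isometry:
  assumes U: "U \<in> carrier_mat m m"
    and iso: "\<And>v w. v \<in> carrier_vec m \<Longrightarrow> w \<in> carrier_vec m \<Longrightarrow> (U *\<^sub>v v) \<bullet>c (U *\<^sub>v w) = v \<bullet>c w"
  shows "unitary_mat m U"
proof (rule unitary_mat_orthonormal_cols[OF U])
  fix i j assume "i < m" "j < m"
  then have "col U j \<bullet>c col U i = (U *\<^sub>v unit_vec m j) \<bullet>c (U *\<^sub>v unit_vec m i)"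
    using U by (simp add: mult_unit_vec_col[OF U])
  also have "\<dots> = unit_vec m j \<bullet>c unit_vec m i" by (intro iso) auto
  also have "\<dots> = (if i = j then 1 else 0)"
  proof -
    have "unit_vec m j \<bullet>c unit_vec m i = (\<Sum>l<m. if l = i \<and> i = j then 1 else (0::complex))"
      unfolding cscalar_prod_sum[OF unit_vec_carrier] using \<open>i < m\<close> \<open>j < m\<close>
      by (intro sum.cong) auto
    then show ?thesis using \<open>i < m\<close> by (cases "i = j") simp_all
  qed
  finally show "col U j \<bullet>c col U i = (if i = j then 1 else 0)" .
qed

section \<open>The spectral theorem for unitary matrices\<close>

text \<open>
  Applying \<open>T - t\<^sub>m\<^sub>-\<^sub>1, \<dots>, T - t\<^sub>0\<close> in turn to a vector, where \<open>t\<^sub>i\<close> are the diagonal entries of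
  \<open>T\<close>, clears its coordinates from the last to the first. The last nonzero vector obtained is an
  eigenvector, and it has every property that \<open>T - c\<close> preserves. For \<open>Z\<close> an invariant subspace this
  finds an eigenvector in it without choosing a basis of the subspace.
\<close>

lemma upper_triangular_invariant_eigenvector:
  fixes T :: "complex mat"
  assumes T: "T \<in> carrier_mat m m" "upper_triangular T"
    and inv: "\<And>y c. y \<in> carrier_vec m \<Longrightarrow> Z y \<Longrightarrow> Z (T *\<^sub>v y - c \<cdot>\<^sub>v y)"
    and y: "y \<in> carrier_vec m" "y \<noteq> 0\<^sub>v m" "Z y"
  shows "\<exists>z \<mu>. z \<in> carrier_vec m \<and> z \<noteq> 0\<^sub>v m \<and> Z z \<and> T *\<^sub>v z = \<mu> \<cdot>\<^sub>v z"
proof -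
  have "\<exists>z \<mu>. z \<in> carrier_vec m \<and> z \<noteq> 0\<^sub>v m \<and> Z z \<and> T *\<^sub>v z = \<mu> \<cdot>\<^sub>v z"
    if "y \<in> carrier_vec m" "y \<noteq> 0\<^sub>v m" "Z y" "j \<le> m" "\<forall>i. j \<le> i \<and> i < m \<longrightarrow> y $ i = 0" for y j
    using that
  proof (induction j arbitrary: y)
    case 0
    then have "y = 0\<^sub>v m" by (intro eq_vecI) auto
    then show ?case using 0 by simp
  next
    case (Suc j)
    define c where "c = T $$ (j, j)"
    define y' where "y' = T *\<^sub>v y - c \<cdot>\<^sub>v y"
    have y': "y' \<in> carrier_vec m" using T Suc.prems(1) by (simp add: y'_def)
    show ?case
    proof (cases "y' = 0\<^sub>v m")
      case True
      have "(T *\<^sub>v y) $ i = (c \<cdot>\<^sub>v y) $ i" if "i < m" for i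
      proof -
        have "y' $ i = 0" using True that by simp
        then show ?thesis using that T Suc.prems(1) by (simp add: y'_def)
      qed
      then have "T *\<^sub>v y = c \<cdot>\<^sub>v y" using T Suc.prems(1) by (intro eq_vecI) auto
      then show ?thesis using Suc.prems by blast
    next
      case False
      have "y' $ i = 0" if i: "j \<le> i" "i < m" for i
      proof -
        have zero: "T $$ (i, l) * y $ l = 0" if "l < m" "l \<noteq> j \<or> i \<noteq> j" for l
        proof (cases "l < i")
          case True
          then show ?thesis using T \<open>i < m\<close> by (auto simp: upper_triangular_def)
        next
          case False
          then have "y $ l = 0" using Suc.prems(5) that i by auto
          then show ?thesis by simp
        qed
        have "(T *\<^sub>v y) $ i = (\<Sum>l<m. T $$ (i, l) * y $ l)"
          using mat_vec_index_sum[OF T(1) Suc.prems(1) i(2)] .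
        also have "\<dots> = (\<Sum>l<m. if l = j \<and> i = j then c * y $ j else 0)"
          using zero by (intro sum.cong) (auto simp: c_def)
        also have "\<dots> = c * y $ i"
          using Suc.prems(4,5) i by (cases "i = j") auto
        finally show ?thesis using i T Suc.prems(1) by (simp add: y'_def)
      qed
      then show ?thesis using Suc.IH[OF y' False] inv[OF Suc.prems(1,3), of c] Suc.prems(4)
        by (auto simp: y'_def)
    qed
  qed
  then show ?thesis using y by (metis linorder_not_less order_refl)
qed

lemma isometry_eigenvalue_unit:
  fixes U :: "complex mat"
  assumes iso: "\<And>v w. v \<in> carrier_vec m \<Longrightarrow> w \<in> carrier_vec m \<Longrightarrow> (U *\<^sub>v v) \<bullet>c (U *\<^sub>v w) = v \<bullet>c w"
    and v: "v \<in> carrier_vec m" "v \<noteq> 0\<^sub>v m" "U *\<^sub>v v = \<mu> \<cdot>\<^sub>v v"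
  shows "cmod \<mu> = 1"
proof -
  have "\<mu> * cnj \<mu> * (v \<bullet>c v) = (U *\<^sub>v v) \<bullet>c (U *\<^sub>v v)"
    unfolding v(3) by (rule cscalar_prod_smult[OF v(1) v(1), symmetric])
  also have "\<dots> = v \<bullet>c v" using iso[OF v(1) v(1)] .
  finally have "\<mu> * cnj \<mu> * (v \<bullet>c v) = v \<bullet>c v" .
  moreover have "v \<bullet>c v \<noteq> 0" using v by simp
  ultimately have "\<mu> * cnj \<mu> = 1" by simp
  then have "complex_of_real ((cmod \<mu>)\<^sup>2) = 1" unfolding complex_norm_square .
  then have "(cmod \<mu>)\<^sup>2 = 1" using of_real_eq_1_iff by blast
  then show ?thesis using norm_ge_zero[of \<mu>] unfolding power2_eq_1_iff by linarith
qed

text \<open>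
  Fewer than \<open>m\<close> orthogonality conditions form a square system with a zero row.
\<close>

lemma orthogonal_complement_nonzero:
  fixes S :: "complex vec set"
  assumes "finite S" "card S < m" "S \<subseteq> carrier_vec m"
  shows "\<exists>x \<in> carrier_vec m. x \<noteq> 0\<^sub>v m \<and> (\<forall>w\<in>S. x \<bullet>c w = 0)"
proof -
  obtain ws where ws: "set ws = S" "length ws = card S"
    using assms(1) by (metis finite_distinct_list distinct_card)
  define k where "k = length ws"
  have k: "k < m" using assms(2) ws by (simp add: k_def)
  define c where "c i = (if i < k then conjugate (ws ! i) else 0\<^sub>v m)" for i
  define B where "B = mat\<^sub>r m m (\<lambda>i. if i = k then 0\<^sub>v m else c i)"
  have wsc: "ws ! i \<in> carrier_vec m" if "i < k" for i
    using that ws assms(3) by (auto simp: k_def)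
  have cc: "c i \<in> carrier_vec m" for i using wsc by (auto simp: c_def)
  have B: "B \<in> carrier_mat m m" by (simp add: B_def)
  have "det B = 0" unfolding B_def using k cc by (intro det_row_0) auto
  then obtain x where x: "x \<in> carrier_vec m" "x \<noteq> 0\<^sub>v m" "B *\<^sub>v x = 0\<^sub>v m"
    using det_0_iff_vec_prod_zero[OF B] by blast
  have "x \<bullet>c w = 0" if "w \<in> S" for w
  proof -
    have "w \<in> set ws" using that unfolding ws(1) .
    then obtain i where i: "i < k" "w = ws ! i" unfolding in_set_conv_nth k_def by blast
    have "0 = (B *\<^sub>v x) $ i" using x i k by simp
    also have "\<dots> = row B i \<bullet> x" using i k B by simp
    also have "row B i = c i" using i k cc wsc by (simp add: B_def carrier_vecD)
    also have "c i \<bullet> x = x \<bullet>c w" using i wsc x by (simp add: c_def comm_scalar_prod[of _ m])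
    finally show ?thesis by simp
  qed
  then show ?thesis using x by blast
qed

text \<open>
  A set rather than a list, because the pairs are put in order only after all have been found.
\<close>

definition orthonormal_eigenpairs :: "nat \<Rightarrow> complex mat \<Rightarrow> (complex \<times> complex vec) set \<Rightarrow> bool" where
  "orthonormal_eigenpairs m U S \<longleftrightarrow>
     (\<forall>(\<mu>, v)\<in>S. v \<in> carrier_vec m \<and> U *\<^sub>v v = \<mu> \<cdot>\<^sub>v v) \<and>
     (\<forall>p\<in>S. \<forall>q\<in>S. snd p \<bullet>c snd q = (if p = q then 1 else 0))"

text \<open>
  The orthogonal complement of eigenvectors of an isometry is invariant, so it contains a further
  eigenvector as long as it is nonzero.
\<close>

lemma isometry_eigenpairs_extend:
  assumes U: "U \<in> carrier_mat m m"
    and iso: "\<And>v w. v \<in> carrier_vec m \<Longrightarrow> w \<in> carrier_vec m \<Longrightarrow> (U *\<^sub>v v) \<bullet>c (U *\<^sub>v w) = v \<bullet>c w"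
    and S: "finite S" "card S < m" "orthonormal_eigenpairs m U S"
  shows "\<exists>p. p \<notin> S \<and> orthonormal_eigenpairs m U (insert p S)"
proof -
  have Sc: "v \<in> carrier_vec m" "U *\<^sub>v v = \<mu> \<cdot>\<^sub>v v" "v \<bullet>c v = 1" "v \<noteq> 0\<^sub>v m" if "(\<mu>, v) \<in> S" for \<mu> v
    using that S(3) unfolding orthonormal_eigenpairs_def by fastforce+
  \<comment> \<open>\<open>W\<close> is the orthogonal complement of the eigenvectors found so far; it is invariant since
    an eigenvalue of an isometry is not zero.\<close>
  define W where "W x \<longleftrightarrow> (\<forall>w\<in>snd ` S. x \<bullet>c w = 0)" for x
  obtain x where x: "x \<in> carrier_vec m" "x \<noteq> 0\<^sub>v m" "W x"
  proof -
    have "card (snd ` S) < m" using S card_image_le[of S snd] by linarith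
    then show thesis using orthogonal_complement_nonzero[of "snd ` S" m] S Sc that
      by (fastforce simp: W_def)
  qed
  have Winv: "W (U *\<^sub>v x - c \<cdot>\<^sub>v x)" if x: "x \<in> carrier_vec m" "W x" for x c
    unfolding W_def
  proof
    fix w assume "w \<in> snd ` S"
    then obtain \<mu> where w: "(\<mu>, w) \<in> S" by force
    note w' = Sc[OF w]
    have "cmod \<mu> = 1" using isometry_eigenvalue_unit[OF iso w'(1,4,2)] .
    then have "\<mu> \<noteq> 0" by auto
    have xw: "x \<bullet>c w = 0" using x(2) \<open>w \<in> snd ` S\<close> unfolding W_def by blast
    have "cnj \<mu> * ((U *\<^sub>v x) \<bullet>c w) = (1 \<cdot>\<^sub>v (U *\<^sub>v x)) \<bullet>c (\<mu> \<cdot>\<^sub>v w)"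
      using U x w'(1) by (subst cscalar_prod_smult[of _ m]) auto
    also have "\<dots> = x \<bullet>c w" using iso[OF x(1) w'(1)] w'(2) by simp
    finally have Uxw: "(U *\<^sub>v x) \<bullet>c w = 0" using xw \<open>\<mu> \<noteq> 0\<close> by simp
    have "(U *\<^sub>v x - c \<cdot>\<^sub>v x) \<bullet>c w = (U *\<^sub>v x) \<bullet>c w - c * (x \<bullet>c w)"
      using U x(1) w'(1)
      by (simp add: cscalar_prod_sum[of _ m] sum_distrib_left sum_subtractf algebra_simps del: index_mult_mat_vec)
    then show "(U *\<^sub>v x - c \<cdot>\<^sub>v x) \<bullet>c w = 0" using Uxw xw by simp
  qed
  obtain es where "char_poly U = (\<Prod>e\<leftarrow>es. [:- e, 1:])" using char_poly_factorized[OF U] by blast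
  then obtain T where T: "T \<in> carrier_mat m m" "upper_triangular T" "similar_mat U T"
    using schur_decomposition_exists[OF U] by blast
  obtain n P Q where carr: "{U, T, P, Q} \<subseteq> carrier_mat n n"
    and inv: "P * Q = 1\<^sub>m n" "Q * P = 1\<^sub>m n" and UT: "U = P * T * Q"
    using similar_matD[OF T(3)] by blast
  have "n = m" using carr U carrier_matD(1)[of U n n] carrier_matD(1)[of U m m] by simp
  then have PQ: "P \<in> carrier_mat m m" "Q \<in> carrier_mat m m" "P * Q = 1\<^sub>m m" "Q * P = 1\<^sub>m m"
    using carr inv by blast+
  have UP: "U *\<^sub>v (P *\<^sub>v y) = P *\<^sub>v (T *\<^sub>v y)" if "y \<in> carrier_vec m" for y
  proof -
    have "U * P = P * T * (Q * P)" unfolding UT using PQ T by (intro assoc_mult_mat) auto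
    then have "U * P = P * T" using PQ T by simp
    then show ?thesis using that PQ T U by (metis assoc_mult_mat_vec)
  qed
  have "\<exists>z \<mu>. z \<in> carrier_vec m \<and> z \<noteq> 0\<^sub>v m \<and> W (P *\<^sub>v z) \<and> T *\<^sub>v z = \<mu> \<cdot>\<^sub>v z"
  proof (rule upper_triangular_invariant_eigenvector[OF T(1,2), where Z = "\<lambda>y. W (P *\<^sub>v y)" and y = "Q *\<^sub>v x"])
    fix y c assume y: "y \<in> carrier_vec m" "W (P *\<^sub>v y)"
    have "P *\<^sub>v (T *\<^sub>v y - c \<cdot>\<^sub>v y) = P *\<^sub>v (T *\<^sub>v y) - P *\<^sub>v (c \<cdot>\<^sub>v y)"
      using PQ T y by (intro mult_minus_distrib_mat_vec) auto
    also have "\<dots> = U *\<^sub>v (P *\<^sub>v y) - c \<cdot>\<^sub>v (P *\<^sub>v y)" unfolding UP[OF y(1)] mult_mat_vec[OF PQ(1) y(1)] ..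
    finally show "W (P *\<^sub>v (T *\<^sub>v y - c \<cdot>\<^sub>v y))" using Winv[of "P *\<^sub>v y"] PQ y by simp
  next
    show "Q *\<^sub>v x \<in> carrier_vec m" using PQ x by simp
    have PQx: "P *\<^sub>v (Q *\<^sub>v x) = x" using PQ x by (metis assoc_mult_mat_vec one_mult_mat_vec)
    show "W (P *\<^sub>v (Q *\<^sub>v x))" using PQx x by simp
    show "Q *\<^sub>v x \<noteq> 0\<^sub>v m"
    proof
      assume "Q *\<^sub>v x = 0\<^sub>v m"
      then show False using PQx x(2) mult_mat_zero_vec[OF PQ(1)] by simp
    qed
  qed
  \<comment> \<open>The columns of \<open>P\<close> need not be orthogonal, so the eigenvector is found in the coordinates
    in which \<open>U\<close> is triangular, and is then mapped back and normalized.\<close>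
  then obtain z \<mu> where z: "z \<in> carrier_vec m" "z \<noteq> 0\<^sub>v m" "W (P *\<^sub>v z)" "T *\<^sub>v z = \<mu> \<cdot>\<^sub>v z" by blast
  define v where "v = P *\<^sub>v z"
  have v: "v \<in> carrier_vec m" using PQ z by (simp add: v_def)
  have Uv: "U *\<^sub>v v = \<mu> \<cdot>\<^sub>v v" 
    unfolding v_def UP[OF z(1)] z(4) mult_mat_vec[OF PQ(1) z(1)] ..
  have v0: "v \<noteq> 0\<^sub>v m"
  proof
    assume "v = 0\<^sub>v m"
    then have "Q *\<^sub>v (P *\<^sub>v z) = 0\<^sub>v m" using mult_mat_zero_vec[OF PQ(2)] by (simp add: v_def)
    then show False using z PQ by (metis assoc_mult_mat_vec one_mult_mat_vec)
  qed
  define s where "s = (\<Sum>i<m. (cmod (v $ i))\<^sup>2)"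
  have vv: "v \<bullet>c v = complex_of_real s" using cscalar_prod_self[OF v] by (simp add: s_def)
  have "s \<ge> 0" unfolding s_def by (intro sum_nonneg) auto
  moreover have "s \<noteq> 0" using vv v0 v by auto
  ultimately have s: "s > 0" by simp
  define a where "a = complex_of_real (1 / sqrt s)"
  define u where "u = a \<cdot>\<^sub>v v"
  have u: "u \<in> carrier_vec m" using v by (simp add: u_def)
  have Uu: "U *\<^sub>v u = \<mu> \<cdot>\<^sub>v u" 
    unfolding u_def mult_mat_vec[OF U v] Uv by (simp add: smult_smult_assoc mult.commute)
  have "a * cnj a * complex_of_real s = complex_of_real ((1 / sqrt s) * (1 / sqrt s) * s)"
    unfolding a_def complex_cnj_complex_of_real of_real_mult ..
  also have "(1 / sqrt s) * (1 / sqrt s) * s = 1" using s by (simp add: field_simps)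
  finally have uu: "u \<bullet>c u = 1" unfolding u_def cscalar_prod_smult[OF v v] vv by simp
  have uw: "u \<bullet>c w = 0" "w \<bullet>c u = 0" if "(\<nu>, w) \<in> S" for \<nu> w
  proof -
    have w: "w \<in> carrier_vec m" using Sc[OF that] by simp
    have "w \<in> snd ` S" using that by force
    then have "v \<bullet>c w = 0" using z(3) unfolding W_def v_def by blast
    then have "(a \<cdot>\<^sub>v v) \<bullet>c (1 \<cdot>\<^sub>v w) = 0" using cscalar_prod_smult[OF v w, of a 1] by simp
    then show "u \<bullet>c w = 0" by (simp add: u_def)
    then show "w \<bullet>c u = 0" using cscalar_prod_commute[OF u w] by simp
  qed
  have "(\<mu>, u) \<notin> S" using uw uu by fastforce
  moreover have "orthonormal_eigenpairs m U (insert (\<mu>, u) S)"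
    using S(3) u Uu uu uw calculation unfolding orthonormal_eigenpairs_def by fastforce
  ultimately show ?thesis by blast
qed

lemma isometry_orthonormal_eigenbasis:
  assumes U: "U \<in> carrier_mat m m"
    and iso: "\<And>v w. v \<in> carrier_vec m \<Longrightarrow> w \<in> carrier_vec m \<Longrightarrow> (U *\<^sub>v v) \<bullet>c (U *\<^sub>v w) = v \<bullet>c w"
  shows "\<exists>S. finite S \<and> card S = m \<and> orthonormal_eigenpairs m U S"
proof -
  have "\<exists>S. finite S \<and> card S = k \<and> orthonormal_eigenpairs m U S" if "k \<le> m" for k
    using that
  proof (induction k)
    case 0
    then show ?case by (intro exI[of _ "{}"]) (simp add: orthonormal_eigenpairs_def)
  next
    case (Suc k)
    then obtain S where "finite S" "card S = k" "orthonormal_eigenpairs m U S" by auto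
    moreover from this obtain p where "p \<notin> S" "orthonormal_eigenpairs m U (insert p S)"
      using isometry_eigenpairs_extend[OF U iso] Suc.prems by (metis Suc_le_lessD)
    ultimately show ?case by (intro exI[of _ "insert p S"]) simp
  qed
  then show ?thesis by simp
qed

text \<open>
  Gives access to the sorting function of lists and to the uniqueness of sorted lists for the order
  in which eigenvalues are listed.
\<close>

lemma class_linorder_of_relation:
  assumes "linear_order r"
  shows "class.linorder (\<lambda>x y. (x, y) \<in> r) (\<lambda>x y. (x, y) \<in> r \<and> x \<noteq> y)"
proof -
  have "\<And>x y. (x, y) \<in> r \<or> (y, x) \<in> r" "\<And>x. (x, x) \<in> r"
    using assms by (auto simp: linear_order_on_def total_on_def partial_order_on_def preorder_on_def refl_on_def) metis
  moreover have "trans r" "antisym r"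
    using assms by (auto simp: linear_order_on_def partial_order_on_def preorder_on_def)
  ultimately show ?thesis
    by unfold_locales (auto dest: transD antisymD)
qed

lemma isometry_eigenvalue_decomposition:
  assumes r: "linear_order r" and U: "U \<in> carrier_mat m m"
    and iso: "\<And>v w. v \<in> carrier_vec m \<Longrightarrow> w \<in> carrier_vec m \<Longrightarrow> (U *\<^sub>v v) \<bullet>c (U *\<^sub>v w) = v \<bullet>c w"
  shows "\<exists>V \<Lambda>. eigenvalue_decomposition r m U V \<Lambda>"
proof -
  interpret rel: linorder "\<lambda>x y. (x, y) \<in> r" "\<lambda>x y. (x, y) \<in> r \<and> x \<noteq> y"
    using class_linorder_of_relation[OF r] .
  obtain S where S: "finite S" "card S = m" "orthonormal_eigenpairs m U S"
    using isometry_orthonormal_eigenbasis[OF U iso] by blast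
  obtain xs where xs: "set xs = S" "distinct xs" using finite_distinct_list[OF S(1)] by blast
  define ys where "ys = rel.sort_key fst xs"
  have ys: "set ys = S" "distinct ys" "sorted_wrt (\<lambda>x y. (x, y) \<in> r) (map fst ys)"
    using xs by (auto simp: ys_def rel.sorted_sort_key)
  have len: "length ys = m" using ys S distinct_card by metis
  define V where "V = mat_of_cols m (map snd ys)"
  define \<Lambda> where "\<Lambda> = mat_diag m (\<lambda>i. fst (ys ! i))"
  have in_S: "(fst (ys ! j), snd (ys ! j)) \<in> S" if "j < m" for j
    using that ys len by (auto simp flip: ys(1))
  then have yc: "snd (ys ! j) \<in> carrier_vec m" "U *\<^sub>v snd (ys ! j) = fst (ys ! j) \<cdot>\<^sub>v snd (ys ! j)"
    if "j < m" for j using that S(3) unfolding orthonormal_eigenpairs_def by blast+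
  have V: "V \<in> carrier_mat m m" using len by (auto simp: V_def)
  have \<Lambda>: "\<Lambda> \<in> carrier_mat m m" by (simp add: \<Lambda>_def)
  have colV: "col V j = snd (ys ! j)" if "j < m" for j
    using that len yc unfolding V_def by (subst col_mat_of_cols) auto
  have uV: "unitary_mat m V"
  proof (rule unitary_mat_orthonormal_cols[OF V])
    fix i j assume ij: "i < m" "j < m"
    have "snd (ys ! j) \<bullet>c snd (ys ! i) = (if ys ! j = ys ! i then 1 else 0)"
      using S(3) in_S[OF ij(1)] in_S[OF ij(2)] unfolding orthonormal_eigenpairs_def by auto
    also have "ys ! j = ys ! i \<longleftrightarrow> i = j" using ys(2) ij len by (auto simp: nth_eq_iff_index_eq)
    finally show "col V j \<bullet>c col V i = (if i = j then 1 else 0)" using ij by (simp add: colV)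
  qed
  have "U * V = V * \<Lambda>"
  proof (rule eq_matI)
    fix i j assume ij: "i < dim_row (V * \<Lambda>)" "j < dim_col (V * \<Lambda>)"
    then have ij: "i < m" "j < m" using V \<Lambda> by auto
    have "(U * V) $$ (i, j) = (U *\<^sub>v col V j) $ i" using ij U V by simp
    also have "\<dots> = (fst (ys ! j) \<cdot>\<^sub>v col V j) $ i" using yc[OF ij(2)] colV[OF ij(2)] by simp
    also have "\<dots> = (V * \<Lambda>) $$ (i, j)"
      using ij V unfolding \<Lambda>_def mat_diag_mult_right[OF V] by simp
    finally show "(U * V) $$ (i, j) = (V * \<Lambda>) $$ (i, j)" .
  qed (use U V \<Lambda> in auto)
  then have "U = V * \<Lambda> * mat_adjoint V"
    using uV U V \<Lambda> mat_adjoint_carrier[OF V] unfolding unitary_mat_def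
    by (metis assoc_mult_mat right_mult_one_mat)
  moreover have "diag_mat \<Lambda> = map fst ys"
    using len by (intro nth_equalityI) (auto simp: diag_mat_def \<Lambda>_def mat_diag_def)
  moreover have "diagonal_mat \<Lambda>" by (auto simp: diagonal_mat_def \<Lambda>_def mat_diag_def)
  ultimately have "eigenvalue_decomposition r m U V \<Lambda>"
    using uV \<Lambda> ys(3) unfolding eigenvalue_decomposition_def by simp
  then show ?thesis by blast
qed

section \<open>Uniqueness of eigenvalue decompositions\<close>

lemma eigenvalue_decomposition_col:
  assumes dec: "eigenvalue_decomposition r m R V \<Lambda>" and j: "j < m"
  shows "col V j \<in> carrier_vec m" "R *\<^sub>v col V j = (\<Lambda> $$ (j, j)) \<cdot>\<^sub>v col V j"
    and "i < m \<Longrightarrow> col V j \<bullet>c col V i = (if i = j then 1 else 0)"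
proof -
  have V: "V \<in> carrier_mat m m" "mat_adjoint V * V = 1\<^sub>m m" and \<Lambda>: "\<Lambda> \<in> carrier_mat m m" "diagonal_mat \<Lambda>"
    and R: "R = V * \<Lambda> * mat_adjoint V"
    using dec by (auto simp: eigenvalue_decomposition_def unitary_mat_def)
  note V' = mat_adjoint_carrier[OF V(1)]
  show "col V j \<in> carrier_vec m" using V j by auto
  show "col V j \<bullet>c col V i = (if i = j then 1 else 0)" if "i < m"
    using adjoint_mult_index[OF V(1) that j] V(2) that j by simp
  have "R * V = V * \<Lambda> * (mat_adjoint V * V)"
    unfolding R by (rule assoc_mult_mat[OF mult_carrier_mat[OF V(1) \<Lambda>(1)] V' V(1)])
  then have RV: "R * V = V * \<Lambda>" using V \<Lambda> by simp
  have Rc: "R \<in> carrier_mat m m" unfolding R using V V' \<Lambda> by auto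
  show "R *\<^sub>v col V j = (\<Lambda> $$ (j, j)) \<cdot>\<^sub>v col V j"
  proof (rule eq_vecI)
    fix i assume "i < dim_vec ((\<Lambda> $$ (j, j)) \<cdot>\<^sub>v col V j)"
    then have i: "i < m" using V by simp
    have "(R *\<^sub>v col V j) $ i = (R * V) $$ (i, j)" using i j V Rc by simp
    also have "\<dots> = (V *\<^sub>v col \<Lambda> j) $ i" unfolding RV using i j V \<Lambda> by simp
    also have "\<dots> = (\<Sum>l<m. V $$ (i, l) * col \<Lambda> j $ l)"
      using V \<Lambda> i j by (intro mat_vec_index_sum) auto
    also have "\<dots> = (\<Sum>l<m. if l = j then V $$ (i, j) * \<Lambda> $$ (j, j) else 0)"
      using \<Lambda> j by (intro sum.cong) (auto simp: diagonal_mat_def)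
    also have "\<dots> = V $$ (i, j) * \<Lambda> $$ (j, j)" using j by simp
    finally show "(R *\<^sub>v col V j) $ i = ((\<Lambda> $$ (j, j)) \<cdot>\<^sub>v col V j) $ i"
      using V i j by simp
  qed (use Rc V in auto)
qed

lemma eigenvalue_decomposition_spectrum:
  assumes dec: "eigenvalue_decomposition r m R V \<Lambda>"
  shows "eigenvalue R \<mu> \<longleftrightarrow> \<mu> \<in> set (diag_mat \<Lambda>)"
proof -
  have V: "V \<in> carrier_mat m m" "mat_adjoint V * V = 1\<^sub>m m" "V * mat_adjoint V = 1\<^sub>m m"
    and \<Lambda>: "\<Lambda> \<in> carrier_mat m m" "diagonal_mat \<Lambda>"
    and R: "R = V * \<Lambda> * mat_adjoint V"
    using dec by (auto simp: eigenvalue_decomposition_def unitary_mat_def)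
  note V' = mat_adjoint_carrier[OF V(1)]
  have Rc: "R \<in> carrier_mat m m" unfolding R using V V' \<Lambda> by auto
  have "similar_mat R \<Lambda>" using V V' \<Lambda> Rc R by (intro similar_matI[of _ _ _ _ m]) auto
  moreover have "upper_triangular \<Lambda>" using \<Lambda> by (auto simp: upper_triangular_def diagonal_mat_def)
  ultimately have "char_poly R = (\<Prod>a\<leftarrow>diag_mat \<Lambda>. [:- a, 1:])"
    using char_poly_similar char_poly_upper_triangular[OF \<Lambda>(1)] by metis
  then show ?thesis
    by (auto simp: eigenvalue_root_char_poly[OF Rc] poly_prod_list prod_list_zero_iff)
qed

text \<open>
  Two orthonormal eigenvectors for one eigenvalue have a nontrivial combination whose first component
  is zero.
\<close>

lemma eigenvalue_decomposition_distinct: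
  assumes m: "0 < m" and dec: "eigenvalue_decomposition r m R V \<Lambda>"
    and R: "R \<in> carrier_mat m m"
    and first: "\<And>v \<mu>. eigenvalue R \<mu> \<Longrightarrow> v \<in> carrier_vec m \<Longrightarrow> R *\<^sub>v v = \<mu> \<cdot>\<^sub>v v \<Longrightarrow> v $ 0 = 0 \<Longrightarrow> v = 0\<^sub>v m"
  shows "distinct (diag_mat \<Lambda>)"
proof -
  note col = eigenvalue_decomposition_col[OF dec]
  have \<Lambda>: "\<Lambda> \<in> carrier_mat m m" using dec by (simp add: eigenvalue_decomposition_def)
  have False if ij: "i < m" "j < m" "i \<noteq> j" and eq: "\<Lambda> $$ (i, i) = \<Lambda> $$ (j, j)" for i j
  proof -
    define \<mu> where "\<mu> = \<Lambda> $$ (i, i)"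
    have "\<mu> \<in> set (diag_mat \<Lambda>)" using ij \<Lambda> by (auto simp: \<mu>_def diag_mat_def)
    then have \<mu>: "eigenvalue R \<mu>" using eigenvalue_decomposition_spectrum[OF dec] by simp
    define v w where "v = col V i" and "w = col V j"
    have v: "v \<in> carrier_vec m" "R *\<^sub>v v = \<mu> \<cdot>\<^sub>v v" and w: "w \<in> carrier_vec m" "R *\<^sub>v w = \<mu> \<cdot>\<^sub>v w"
      using col ij eq by (auto simp: v_def w_def \<mu>_def)
    have vv: "v \<bullet>c v = 1" and wv: "w \<bullet>c v = 0" and ww: "w \<bullet>c w = 1"
      using col(3) ij by (auto simp: v_def w_def)
    \<comment> \<open>Built to have first component zero.\<close>
    define u where "u = w $ 0 \<cdot>\<^sub>v v - v $ 0 \<cdot>\<^sub>v w"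
    have u: "u \<in> carrier_vec m" using v w by (simp add: u_def)
    have "R *\<^sub>v u = R *\<^sub>v (w $ 0 \<cdot>\<^sub>v v) - R *\<^sub>v (v $ 0 \<cdot>\<^sub>v w)"
      unfolding u_def using R v w by (intro mult_minus_distrib_mat_vec) auto
    also have "\<dots> = w $ 0 \<cdot>\<^sub>v (\<mu> \<cdot>\<^sub>v v) - v $ 0 \<cdot>\<^sub>v (\<mu> \<cdot>\<^sub>v w)"
      unfolding mult_mat_vec[OF R v(1)] mult_mat_vec[OF R w(1)] v(2) w(2) ..
    also have "\<dots> = \<mu> \<cdot>\<^sub>v u" using v w by (intro eq_vecI) (auto simp: u_def algebra_simps)
    finally have "u = 0\<^sub>v m" using u v w m by (intro first[OF \<mu>]) (auto simp: u_def)
    then have "0 = u \<bullet>c v" using v by simp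
    also have "\<dots> = w $ 0 * (v \<bullet>c v) - v $ 0 * (w \<bullet>c v)"
      using v w by (simp add: u_def cscalar_prod_sum[of _ m] sum_distrib_left sum_subtractf algebra_simps)
    finally have "w $ 0 = 0" using vv wv by simp
    then have "w = 0\<^sub>v m" using first[OF \<mu> w] by simp
    then show False using ww by simp
  qed
  then have "inj_on (\<lambda>i. \<Lambda> $$ (i, i)) {..<m}" by (intro inj_onI) auto
  then show ?thesis using \<Lambda> by (simp add: diag_mat_def distinct_map lessThan_atLeast0)
qed

text \<open>
  Both matrices have the same moduli profile \<open>C\<close> for every eigenvalue. Applied to a vector with first
  component zero, the profile makes it vanish, so both spectra are simple; for unit vectors, it fixes
  the modulus of the first component and hence all others.
\<close>

lemma eigenvalue_decomposition_determined:
  assumes m: "0 < m" and r: "linear_order r"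
    and R: "R \<in> carrier_mat m m" and R': "R' \<in> carrier_mat m m"
    and dec: "eigenvalue_decomposition r m R V \<Lambda>" and dec': "eigenvalue_decomposition r m R' V' \<Lambda>'"
    and prof: "\<And>v \<mu> i. eigenvalue R \<mu> \<Longrightarrow> v \<in> carrier_vec m \<Longrightarrow> R *\<^sub>v v = \<mu> \<cdot>\<^sub>v v \<Longrightarrow> i < m \<Longrightarrow>
       cmod (v $ i) = C \<mu> i * cmod (v $ 0)"
    and prof': "\<And>v \<mu> i. eigenvalue R' \<mu> \<Longrightarrow> v \<in> carrier_vec m \<Longrightarrow> R' *\<^sub>v v = \<mu> \<cdot>\<^sub>v v \<Longrightarrow> i < m \<Longrightarrow>
       cmod (v $ i) = C \<mu> i * cmod (v $ 0)"
    and spec: "\<And>\<mu>. eigenvalue R \<mu> \<longleftrightarrow> eigenvalue R' \<mu>"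
  shows "\<Lambda> = \<Lambda>'" and "\<forall>i<m. \<forall>j<m. cmod (V $$ (i, j)) = cmod (V' $$ (i, j))"
proof -
  interpret rel: linorder "\<lambda>x y. (x, y) \<in> r" "\<lambda>x y. (x, y) \<in> r \<and> x \<noteq> y"
    using class_linorder_of_relation[OF r] .
  have V: "V \<in> carrier_mat m m" "V' \<in> carrier_mat m m"
    and \<Lambda>: "\<Lambda> \<in> carrier_mat m m" "diagonal_mat \<Lambda>" "\<Lambda>' \<in> carrier_mat m m" "diagonal_mat \<Lambda>'"
    using dec dec' by (auto simp: eigenvalue_decomposition_def unitary_mat_def)
  have "distinct (diag_mat \<Lambda>)"
  proof (rule eigenvalue_decomposition_distinct[OF m dec R])
    fix v \<mu> assume "eigenvalue R \<mu>" "v \<in> carrier_vec m" "R *\<^sub>v v = \<mu> \<cdot>\<^sub>v v" "v $ 0 = 0"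
    then show "v = 0\<^sub>v m" using prof[of \<mu> v] by (intro eq_vecI) auto
  qed
  moreover have "distinct (diag_mat \<Lambda>')"
  proof (rule eigenvalue_decomposition_distinct[OF m dec' R'])
    fix v \<mu> assume "eigenvalue R' \<mu>" "v \<in> carrier_vec m" "R' *\<^sub>v v = \<mu> \<cdot>\<^sub>v v" "v $ 0 = 0"
    then show "v = 0\<^sub>v m" using prof'[of \<mu> v] by (intro eq_vecI) auto
  qed
  moreover have "set (diag_mat \<Lambda>) = set (diag_mat \<Lambda>')"
    using spec eigenvalue_decomposition_spectrum[OF dec] eigenvalue_decomposition_spectrum[OF dec'] by auto
  moreover have "sorted_wrt (\<lambda>x y. (x, y) \<in> r) (diag_mat \<Lambda>)" "sorted_wrt (\<lambda>x y. (x, y) \<in> r) (diag_mat \<Lambda>')"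
    using dec dec' by (auto simp: eigenvalue_decomposition_def)
  ultimately have diag: "diag_mat \<Lambda> = diag_mat \<Lambda>'" by (intro rel.sorted_distinct_set_unique)
  have entry: "\<Lambda> $$ (j, j) = \<Lambda>' $$ (j, j)" if "j < m" for j
    using arg_cong[OF diag, of "\<lambda>xs. xs ! j"] that \<Lambda> by (simp add: diag_mat_def)
  show "\<Lambda> = \<Lambda>'"
  proof (rule eq_matI)
    fix i j assume "i < dim_row \<Lambda>'" "j < dim_col \<Lambda>'"
    then show "\<Lambda> $$ (i, j) = \<Lambda>' $$ (i, j)"
      using \<Lambda> entry by (cases "i = j") (auto simp: diagonal_mat_def)
  qed (use \<Lambda> in auto)
  show "\<forall>i<m. \<forall>j<m. cmod (V $$ (i, j)) = cmod (V' $$ (i, j))"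
  proof (intro allI impI)
    fix i j assume i: "i < m" and j: "j < m"
    define \<mu> where "\<mu> = \<Lambda> $$ (j, j)"
    define v w where "v = col V j" and "w = col V' j"
    have "\<mu> \<in> set (diag_mat \<Lambda>)" using j \<Lambda> by (auto simp: \<mu>_def diag_mat_def)
    then have \<mu>: "eigenvalue R \<mu>" "eigenvalue R' \<mu>"
      using eigenvalue_decomposition_spectrum[OF dec] spec by auto
    have v: "v \<in> carrier_vec m" "R *\<^sub>v v = \<mu> \<cdot>\<^sub>v v" "v \<bullet>c v = 1"
      using eigenvalue_decomposition_col[OF dec j] j by (auto simp: v_def \<mu>_def)
    have w: "w \<in> carrier_vec m" "R' *\<^sub>v w = \<mu> \<cdot>\<^sub>v w" "w \<bullet>c w = 1"
      using eigenvalue_decomposition_col[OF dec' j] j entry by (auto simp: w_def \<mu>_def)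
    define c where "c = (\<Sum>l<m. (C \<mu> l)\<^sup>2)"
    have norm: "c * (cmod (x $ 0))\<^sup>2 = 1"
      if x: "x \<in> carrier_vec m" "x \<bullet>c x = 1" and p: "\<And>l. l < m \<Longrightarrow> cmod (x $ l) = C \<mu> l * cmod (x $ 0)" for x
    proof -
      have "(\<Sum>l<m. (cmod (x $ l))\<^sup>2) = 1" using cscalar_prod_self[OF x(1)] x(2) by (metis of_real_eq_1_iff)
      also have "(\<Sum>l<m. (cmod (x $ l))\<^sup>2) = (\<Sum>l<m. (C \<mu> l)\<^sup>2 * (cmod (x $ 0))\<^sup>2)"
        by (intro sum.cong refl) (metis p lessThan_iff power_mult_distrib)
      finally show ?thesis unfolding c_def sum_distrib_right .
    qed
    note pv = prof[OF \<mu>(1) v(1,2)] and pw = prof'[OF \<mu>(2) w(1,2)]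
    have "c * (cmod (v $ 0))\<^sup>2 = 1" "c * (cmod (w $ 0))\<^sup>2 = 1"
      using norm[OF v(1,3) pv] norm[OF w(1,3) pw] by auto
    then have "(cmod (v $ 0))\<^sup>2 = (cmod (w $ 0))\<^sup>2" by (metis mult_cancel_left mult_zero_left zero_neq_one)
    then have "cmod (v $ 0) = cmod (w $ 0)" by (simp add: power2_eq_iff_nonneg)
    then have "cmod (v $ i) = cmod (w $ i)" using pv[OF i] pw[OF i] by simp
    then show "cmod (V $$ (i, j)) = cmod (V' $$ (i, j))" using V i j by (simp add: v_def w_def)
  qed
qed

section \<open>The rotation matrices and their products\<close>

lemma Gtilde_index:
  "dim_row (Gtilde d) = 2" "dim_col (Gtilde d) = 2"
  "Gtilde d $$ (0, 0) = - d"
  "Gtilde d $$ (0, Suc 0) = complex_of_real (sqrt (1 - (cmod d)\<^sup>2))"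
  "Gtilde d $$ (Suc 0, 0) = complex_of_real (sqrt (1 - (cmod d)\<^sup>2))"
  "Gtilde d $$ (Suc 0, Suc 0) = cnj d"
  by (simp_all add: Gtilde_def Let_def mat_of_rows_list_def)

lemma G_mat_carrier:
  assumes "1 \<le> k" "k \<le> n"
  shows "G_mat n \<delta> k \<in> carrier_mat (n + 1) (n + 1)"
  using assms by (intro carrier_matI) (simp_all add: G_mat_def Let_def Gtilde_index)

lemma G_mat_index:
  fixes \<delta> :: "nat \<Rightarrow> complex"
  assumes "j < n" "i \<le> n" "l \<le> n"
  defines "\<eta> \<equiv> complex_of_real (sqrt (1 - (cmod (\<delta> (Suc j)))\<^sup>2))"
  shows "G_mat n \<delta> (Suc j) $$ (i, l) =
    (if i = j then (if l = j then - \<delta> (Suc j) else if l = Suc j then \<eta> else 0)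
     else if i = Suc j then (if l = j then \<eta> else if l = Suc j then cnj (\<delta> (Suc j)) else 0)
     else if l = i then 1 else 0)"
proof -
  let ?r = "n - Suc j"
  define B where "B = diag_block_mat [Gtilde (\<delta> (Suc j)), 1\<^sub>m ?r]"
  have dim_B: "dim_row B = 2 + ?r" "dim_col B = 2 + ?r"
    by (simp_all add: B_def Let_def Gtilde_index)
  have B: "B $$ (p, q) = (if p < 2 then if q < 2 then Gtilde (\<delta> (Suc j)) $$ (p, q) else 0
      else if q < 2 then 0 else if p = q then 1 else 0)" if "p < 2 + ?r" "q < 2 + ?r" for p q
    using that by (auto simp: B_def Let_def Gtilde_index)
  have "G_mat n \<delta> (Suc j) = four_block_mat (1\<^sub>m j) (0\<^sub>m j (dim_col B)) (0\<^sub>m (dim_row B) j) B"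
    by (simp add: G_mat_def B_def Let_def)
  moreover have "i < j + (2 + ?r)" "l < j + (2 + ?r)" using assms(1-3) by auto
  ultimately have G: "G_mat n \<delta> (Suc j) $$ (i, l) =
      (if i < j then if l < j then (if i = l then 1 else 0) else 0
       else if l < j then 0 else B $$ (i - j, l - j))"
    using dim_B by simp
  have B': "B $$ (i - j, l - j) = (if i - j < 2 then if l - j < 2 then Gtilde (\<delta> (Suc j)) $$ (i - j, l - j) else 0
      else if l - j < 2 then 0 else if i - j = l - j then 1 else 0)"
    using assms(1-3) by (intro B) auto
  have position: "x < j \<or> x = j \<or> x = Suc j \<or> Suc j < x" for x by arith
  show ?thesis using position[of i] position[of l]
    unfolding G B' \<eta>_def by (elim disjE) (auto simp: Gtilde_index)
qed

lemma G_mat_mult_vec: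
  assumes "1 \<le> k" "k \<le> n" "y \<in> carrier_vec (n + 1)" "i \<le> n"
  shows "(G_mat n \<delta> k *\<^sub>v y) $ i = givens \<delta> k (($) y) i"
proof -
  obtain j where k: "k = Suc j" using assms(1) by (cases k) auto
  define \<eta> where "\<eta> = complex_of_real (sqrt (1 - (cmod (\<delta> (Suc j)))\<^sup>2))"
  have j: "j < n" using assms k by simp
  have "(G_mat n \<delta> k *\<^sub>v y) $ i = (\<Sum>l<n+1. G_mat n \<delta> (Suc j) $$ (i, l) * y $ l)"
    using mat_vec_index_sum[OF G_mat_carrier[OF assms(1,2)] assms(3), of i \<delta>] assms(4) k by simp
  also have "\<dots> = givens \<delta> k (($) y) i"
  proof -
    have two: "(\<Sum>l<n+1. (if l = j then a else if l = Suc j then b else 0) * y $ l) = a * y $ j + b * y $ Suc j" for a b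
    proof -
      have "(\<Sum>l<n+1. (if l = j then a else if l = Suc j then b else 0) * y $ l)
        = (\<Sum>l<n+1. (if l = j then a * y $ j else 0) + (if l = Suc j then b * y $ Suc j else 0))"
        by (intro sum.cong) auto
      then show ?thesis using j by (simp add: sum.distrib)
    qed
    have one: "(\<Sum>l<n+1. (if l = i then 1 else 0) * y $ l) = y $ i"
    proof -
      have "(\<Sum>l<n+1. (if l = i then 1 else 0) * y $ l) = (\<Sum>l<n+1. if l = i then y $ i else 0)"
        by (intro sum.cong) auto
      then show ?thesis using assms(4) by simp
    qed
    have entry: "G_mat n \<delta> (Suc j) $$ (i, l) =
      (if i = j then (if l = j then - \<delta> (Suc j) else if l = Suc j then \<eta> else 0)
       else if i = Suc j then (if l = j then \<eta> else if l = Suc j then cnj (\<delta> (Suc j)) else 0)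
       else if l = i then 1 else 0)" if "l < n + 1" for l
      unfolding \<eta>_def using j assms(4) that by (intro G_mat_index) auto
    show ?thesis
    proof (cases "i = j")
      case True
      then have "(\<Sum>l<n+1. G_mat n \<delta> (Suc j) $$ (i, l) * y $ l) =
        (\<Sum>l<n+1. (if l = j then - \<delta> (Suc j) else if l = Suc j then \<eta> else 0) * y $ l)"
        by (intro sum.cong refl) (subst entry, simp_all)
      then show ?thesis unfolding two using True by (simp add: givens_def k \<eta>_def Let_def)
    next
      case neq: False
      show ?thesis
      proof (cases "i = Suc j")
        case True
        then have "(\<Sum>l<n+1. G_mat n \<delta> (Suc j) $$ (i, l) * y $ l) =
          (\<Sum>l<n+1. (if l = j then \<eta> else if l = Suc j then cnj (\<delta> (Suc j)) else 0) * y $ l)"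
          by (intro sum.cong refl) (subst entry, simp_all)
        then show ?thesis unfolding two using True by (simp add: givens_def k \<eta>_def Let_def)
      next
        case False
        then have "(\<Sum>l<n+1. G_mat n \<delta> (Suc j) $$ (i, l) * y $ l) =
          (\<Sum>l<n+1. (if l = i then 1 else 0) * y $ l)"
          using neq by (intro sum.cong refl) (subst entry, simp_all)
        then show ?thesis unfolding one using False neq by (simp add: givens_def k Let_def)
      qed
    qed
  qed
  finally show ?thesis .
qed

lemma M_mat_Cons: "M_mat n \<delta> (k # \<pi>) = G_mat n \<delta> k * M_mat n \<delta> \<pi>"
  by (simp add: M_mat_def)

lemma M_mat_carrier:
  assumes "set \<pi> \<subseteq> {1..n}"
  shows "M_mat n \<delta> \<pi> \<in> carrier_mat (n + 1) (n + 1)"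
  using assms
proof (induction \<pi>)
  case Nil
  show ?case by (simp add: M_mat_def)
next
  case (Cons k \<pi>)
  then show ?case unfolding M_mat_Cons by (intro mult_carrier_mat[OF G_mat_carrier]) auto
qed

lemma M_mat_mult_vec:
  assumes "set \<pi> \<subseteq> {1..n}" "y \<in> carrier_vec (n + 1)" "i \<le> n"
  shows "(M_mat n \<delta> \<pi> *\<^sub>v y) $ i = act \<delta> \<pi> (($) y) i"
  using assms(1,3)
proof (induction \<pi> arbitrary: i)
  case Nil
  then show ?case using assms(2) by (simp add: M_mat_def)
next
  case (Cons k \<pi>)
  have k: "1 \<le> k" "k \<le> n" and \<pi>: "set \<pi> \<subseteq> {1..n}" using Cons.prems by auto
  note M = M_mat_carrier[OF \<pi>, of \<delta>]
  have My: "M_mat n \<delta> \<pi> *\<^sub>v y \<in> carrier_vec (n + 1)" using M assms(2) by simp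
  have "(M_mat n \<delta> (k # \<pi>) *\<^sub>v y) $ i = (G_mat n \<delta> k *\<^sub>v (M_mat n \<delta> \<pi> *\<^sub>v y)) $ i"
    unfolding M_mat_Cons assoc_mult_mat_vec[OF G_mat_carrier[OF k] M assms(2)] ..
  also have "\<dots> = givens \<delta> k (($) (M_mat n \<delta> \<pi> *\<^sub>v y)) i"
    using G_mat_mult_vec[OF k My Cons.prems(2)] .
  also have "\<dots> = givens \<delta> k (act \<delta> \<pi> (($) y)) i"
    using k Cons.prems(2) by (intro givens_cong Cons.IH \<pi>) auto
  finally show ?case by simp
qed

section \<open>Inverses and square roots of diagonal matrices\<close>

text \<open>
  Injectivity is how invertibility will be checked, both for \<open>\<eta>\<^sub>A\<close> and for \<open>A\<^sup>* M + I\<close>.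
\<close>

lemma inv_mat_inverse:
  assumes M: "M \<in> carrier_mat m m"
    and inj: "\<And>v. v \<in> carrier_vec m \<Longrightarrow> M *\<^sub>v v = 0\<^sub>v m \<Longrightarrow> v = 0\<^sub>v m"
  shows "inv_mat M \<in> carrier_mat m m" "M * inv_mat M = 1\<^sub>m m" "inv_mat M * M = 1\<^sub>m m"
proof -
  have "det M \<noteq> 0" using det_0_iff_vec_prod_zero[OF M] inj by blast
  then have "M \<in> Units (ring_mat TYPE(complex) m undefined)" by (rule det_non_zero_imp_unit[OF M])
  then obtain B where "mat_inverse M = Some B" using mat_inverse(1)[OF M, of undefined] by (cases "mat_inverse M") blast+
  then have "inv_mat M = B" "M * B = 1\<^sub>m m \<and> B * M = 1\<^sub>m m \<and> B \<in> carrier_mat m m"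
    using mat_inverse(2)[OF M] by (auto simp: inv_mat_def)
  then show "inv_mat M \<in> carrier_mat m m" "M * inv_mat M = 1\<^sub>m m" "inv_mat M * M = 1\<^sub>m m" by auto
qed

lemma mat_diag_mult_vec_index:
  fixes f :: "nat \<Rightarrow> complex"
  assumes "v \<in> carrier_vec m" "i < m"
  shows "(mat_diag m f *\<^sub>v v) $ i = f i * v $ i"
proof -
  have "(mat_diag m f *\<^sub>v v) $ i = (\<Sum>j<m. mat_diag m f $$ (i, j) * v $ j)"
    using assms by (intro mat_vec_index_sum) auto
  also have "\<dots> = (\<Sum>j<m. if j = i then f i * v $ i else 0)"
    using assms by (intro sum.cong) (auto simp: mat_diag_def)
  finally show ?thesis using assms by simp
qed

lemma psd_mat_diag:
  assumes "\<And>i. i < m \<Longrightarrow> 0 \<le> e i"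
  shows "psd_mat m (mat_diag m (\<lambda>i. complex_of_real (e i)))" (is "psd_mat m ?E")
  unfolding psd_mat_def
proof (intro conjI ballI)
  show "?E \<in> carrier_mat m m" by simp
  show "mat_adjoint ?E = ?E"
    by (rule eq_matI) (auto simp: mat_adjoint_index mat_diag_def)
  fix v :: "complex vec" assume v: "v \<in> carrier_vec m"
  have "(?E *\<^sub>v v) \<bullet>c v = (\<Sum>i<m. complex_of_real (e i * (cmod (v $ i))\<^sup>2))"
    unfolding cscalar_prod_sum[OF v]
  proof (intro sum.cong refl)
    fix i assume "i \<in> {..<m}"
    then have "(?E *\<^sub>v v) $ i = complex_of_real (e i) * v $ i" using v by (intro mat_diag_mult_vec_index) auto
    then show "(?E *\<^sub>v v) $ i * cnj (v $ i) = complex_of_real (e i * (cmod (v $ i))\<^sup>2)"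
      unfolding of_real_mult complex_norm_square by simp
  qed
  also have "\<dots> = complex_of_real (\<Sum>i<m. e i * (cmod (v $ i))\<^sup>2)" unfolding of_real_sum ..
  finally have "Re ((?E *\<^sub>v v) \<bullet>c v) = (\<Sum>i<m. e i * (cmod (v $ i))\<^sup>2)"
    by (simp only: Re_complex_of_real)
  then show "0 \<le> Re ((?E *\<^sub>v v) \<bullet>c v)" using assms by (simp only:) (intro sum_nonneg mult_nonneg_nonneg; simp)
qed

text \<open>
  If \<open>S\<close> is positive semidefinite with \<open>S\<^sup>2 = E\<^sup>2\<close>, then \<open>w = (S - e\<^sub>j) u\<close>, with \<open>u\<close> the \<open>j\<close>-th unit
  vector, satisfies \<open>S w = - e\<^sub>j w\<close>. As \<open>S\<close> has no negative eigenvalues, \<open>w = 0\<close>; so \<open>S\<close> and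
  \<open>E\<close> have the same columns.
\<close>

lemma sqrt_mat_diag:
  assumes pos: "\<And>i. i < m \<Longrightarrow> 0 < e i"
  shows "sqrt_mat (mat_diag m (\<lambda>i. complex_of_real (e i * e i))) = mat_diag m (\<lambda>i. complex_of_real (e i))"
    (is "sqrt_mat ?X = ?E")
  unfolding sqrt_mat_def
proof (rule the_equality)
  have dim: "dim_row ?X = m" by (simp add: mat_diag_def)
  have EE: "?E * ?E = ?X" by simp
  have Ec: "?E \<in> carrier_mat m m" by simp
  show "psd_mat (dim_row ?X) ?E \<and> ?E * ?E = ?X"
    unfolding dim EE using psd_mat_diag[of m e] pos less_imp_le by blast
  fix S assume "psd_mat (dim_row ?X) S \<and> S * S = ?X"
  then have S: "S \<in> carrier_mat m m" "\<And>v. v \<in> carrier_vec m \<Longrightarrow> 0 \<le> Re ((S *\<^sub>v v) \<bullet>c v)"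
    and SS: "S * S = ?E * ?E" unfolding dim psd_mat_def EE by auto
  have "col S j = col ?E j" if j: "j < m" for j
  proof -
    define u :: "complex vec" where "u = unit_vec m j"
    have u: "u \<in> carrier_vec m" by (simp add: u_def)
    define w where "w = S *\<^sub>v u - complex_of_real (e j) \<cdot>\<^sub>v u"
    have Su: "S *\<^sub>v u \<in> carrier_vec m" and w: "w \<in> carrier_vec m" using S(1) u by (auto simp: w_def)
    have Eu: "?E *\<^sub>v u = complex_of_real (e j) \<cdot>\<^sub>v u"
    proof (rule eq_vecI)
      fix i assume "i < dim_vec (complex_of_real (e j) \<cdot>\<^sub>v u)"
      then have i: "i < m" by (simp add: u_def)
      then show "(?E *\<^sub>v u) $ i = (complex_of_real (e j) \<cdot>\<^sub>v u) $ i"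
        using j unfolding mat_diag_mult_vec_index[OF u i] by (simp add: u_def)
    qed (use u in \<open>auto simp: mat_diag_def\<close>)
    have "S *\<^sub>v (S *\<^sub>v u) = ?E *\<^sub>v (?E *\<^sub>v u)"
      using assoc_mult_mat_vec[OF S(1) S(1) u] assoc_mult_mat_vec[OF Ec Ec u] SS by simp
    also have "\<dots> = complex_of_real (e j) \<cdot>\<^sub>v (complex_of_real (e j) \<cdot>\<^sub>v u)"
      unfolding Eu mult_mat_vec[OF Ec u] ..
    finally have SSu: "S *\<^sub>v (S *\<^sub>v u) = complex_of_real (e j) \<cdot>\<^sub>v (complex_of_real (e j) \<cdot>\<^sub>v u)" .
    have "S *\<^sub>v w = S *\<^sub>v (S *\<^sub>v u) - S *\<^sub>v (complex_of_real (e j) \<cdot>\<^sub>v u)"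
      unfolding w_def using S(1) u Su by (intro mult_minus_distrib_mat_vec) auto
    also have "\<dots> = (- complex_of_real (e j)) \<cdot>\<^sub>v w"
      unfolding SSu mult_mat_vec[OF S(1) u] using u Su S(1)
      by (intro eq_vecI) (auto simp: w_def algebra_simps simp del: index_mult_mat_vec)
    finally have "(S *\<^sub>v w) \<bullet>c w = ((- complex_of_real (e j)) \<cdot>\<^sub>v w) \<bullet>c (1 \<cdot>\<^sub>v w)" by simp
    also have "\<dots> = - complex_of_real (e j) * (w \<bullet>c w)" unfolding cscalar_prod_smult[OF w w] by simp
    finally have "Re ((S *\<^sub>v w) \<bullet>c w) = - e j * (\<Sum>i<m. (cmod (w $ i))\<^sup>2)"
      unfolding cscalar_prod_self[OF w] by simp
    then have "e j * (\<Sum>i<m. (cmod (w $ i))\<^sup>2) \<le> 0" using S(2)[OF w] by simp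
    then have "(\<Sum>i<m. (cmod (w $ i))\<^sup>2) \<le> 0" using pos[OF j] by (simp add: mult_le_0_iff)
    then have "(\<Sum>i<m. (cmod (w $ i))\<^sup>2) = 0" by (intro antisym sum_nonneg) auto
    then have "w = 0\<^sub>v m" using w cscalar_prod_self[OF w] by simp
    have "S *\<^sub>v u = complex_of_real (e j) \<cdot>\<^sub>v u"
    proof (rule eq_vecI)
      fix i assume "i < dim_vec (complex_of_real (e j) \<cdot>\<^sub>v u)"
      then have i: "i < m" using u by simp
      have "w $ i = 0" using \<open>w = 0\<^sub>v m\<close> i by simp
      then show "(S *\<^sub>v u) $ i = (complex_of_real (e j) \<cdot>\<^sub>v u) $ i"
        using i u Su S(1) by (simp add: w_def del: index_mult_mat_vec)
    qed (use u S(1) in auto)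
    then have "S *\<^sub>v u = ?E *\<^sub>v u" unfolding Eu .
    then show ?thesis unfolding u_def mult_unit_vec_col[OF S(1) j] mult_unit_vec_col[OF Ec j] .
  qed
  then show "S = ?E" using S(1) carrier_matD[OF Ec] by (intro mat_col_eqI) simp_all
qed

section \<open>The graph of the transformed matrix\<close>

text \<open>
  The order of the factors is a parameter of the lemmas and not of the locale, since two orders are
  compared at the end.
\<close>

locale diagonal_cayley =
  fixes n :: nat and \<delta> :: "nat \<Rightarrow> complex" and A :: "complex mat"
  assumes delta: "\<And>k. k \<in> {1..n} \<Longrightarrow> cmod (\<delta> k) < 1"
    and A: "A \<in> carrier_mat (n + 1) (n + 1)" "diagonal_mat A"
    and A_entry: "\<And>i. i < n + 1 \<Longrightarrow> cmod (A $$ (i, i)) < 1"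
begin

definition a :: "nat \<Rightarrow> complex" where "a i = A $$ (i, i)"

text \<open>
  The diagonal entries of \<open>\<eta>\<^sub>A\<close>.
\<close>

definition e :: "nat \<Rightarrow> real" where "e i = sqrt (1 - (cmod (a i))\<^sup>2)"

lemma a_less: "i \<le> n \<Longrightarrow> cmod (a i) < 1"
  using A_entry by (simp add: a_def)

lemma e_pos: "i \<le> n \<Longrightarrow> 0 < e i"
  using a_less[of i] by (simp add: e_def abs_square_less_1)

lemma e_square:
  assumes "i \<le> n"
  shows "complex_of_real (e i * e i) = 1 - a i * cnj (a i)"
proof -
  have "e i * e i = 1 - (cmod (a i))\<^sup>2" using a_less[OF assms] by (simp add: e_def abs_square_le_1)
  then show ?thesis by (simp only: of_real_diff of_real_1 complex_norm_square)
qed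

lemma A_index: "i < n + 1 \<Longrightarrow> j < n + 1 \<Longrightarrow> A $$ (i, j) = (if i = j then a i else 0)"
  using A by (simp add: a_def diagonal_mat_def)

lemma A_eq: "A = mat_diag (n + 1) a"
proof (rule eq_matI)
  fix i j assume "i < dim_row (mat_diag (n + 1) a)" "j < dim_col (mat_diag (n + 1) a)"
  then have "i < n + 1" "j < n + 1" by (simp_all add: mat_diag_def)
  then show "A $$ (i, j) = mat_diag (n + 1) a $$ (i, j)" by (simp add: A_index mat_diag_def)
qed (use A(1) in \<open>simp_all add: mat_diag_def\<close>)

lemma adjoint_A_eq: "mat_adjoint A = mat_diag (n + 1) (\<lambda>i. cnj (a i))"
proof (rule eq_matI)
  fix i j assume "i < dim_row (mat_diag (n + 1) (\<lambda>i. cnj (a i)))" "j < dim_col (mat_diag (n + 1) (\<lambda>i. cnj (a i)))"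
  then have "i < n + 1" "j < n + 1" by (simp_all add: mat_diag_def)
  then show "mat_adjoint A $$ (i, j) = mat_diag (n + 1) (\<lambda>i. cnj (a i)) $$ (i, j)"
    using A(1) by (simp add: mat_adjoint_index A_index mat_diag_def)
qed (use A(1) in \<open>simp_all add: mat_diag_def\<close>)

lemma sqrt_defect: "sqrt_mat (1\<^sub>m (n + 1) - mat_adjoint A * A) = mat_diag (n + 1) (\<lambda>i. complex_of_real (e i))"
proof -
  have "mat_adjoint A * A = mat_diag (n + 1) (\<lambda>i. cnj (a i)) * mat_diag (n + 1) a"
    by (rule arg_cong2[OF adjoint_A_eq A_eq])
  then have "mat_adjoint A * A = mat_diag (n + 1) (\<lambda>i. cnj (a i) * a i)" unfolding mat_diag_diag .
  moreover have "1\<^sub>m (n + 1) - mat_diag (n + 1) (\<lambda>i. cnj (a i) * a i) = mat_diag (n + 1) (\<lambda>i. complex_of_real (e i * e i))"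
    by (rule eq_matI) (auto simp: mat_diag_def e_square simp del: of_real_mult)
  ultimately have "1\<^sub>m (n + 1) - mat_adjoint A * A = mat_diag (n + 1) (\<lambda>i. complex_of_real (e i * e i))" by simp
  then show ?thesis using sqrt_mat_diag[of "n + 1" e] e_pos by simp
qed

text \<open>
  Numerator and denominator of the matrix Cayley transform \<open>R\<close>.
\<close>

abbreviation P :: "nat list \<Rightarrow> complex mat" where
  "P \<pi> \<equiv> A + M_mat n \<delta> \<pi>"

abbreviation Q :: "nat list \<Rightarrow> complex mat" where
  "Q \<pi> \<equiv> mat_adjoint A * M_mat n \<delta> \<pi> + 1\<^sub>m (n + 1)"

context
  fixes \<pi> :: "nat list"
  assumes \<pi>: "set \<pi> \<subseteq> {1..n}"
begin

lemma P_index: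
  assumes "y \<in> carrier_vec (n + 1)" "i \<le> n"
  shows "(P \<pi> *\<^sub>v y) $ i = a i * y $ i + act \<delta> \<pi> (($) y) i"
proof -
  note M = M_mat_carrier[OF \<pi>, of \<delta>]
  have "P \<pi> *\<^sub>v y = A *\<^sub>v y + M_mat n \<delta> \<pi> *\<^sub>v y" by (rule add_mult_distrib_mat_vec[OF A(1) M assms(1)])
  then have "(P \<pi> *\<^sub>v y) $ i = (A *\<^sub>v y) $ i + (M_mat n \<delta> \<pi> *\<^sub>v y) $ i" using M assms by simp
  moreover have "(A *\<^sub>v y) $ i = a i * y $ i"
    using mat_diag_mult_vec_index[OF assms(1), of i a] assms(2) unfolding A_eq[symmetric] by simp
  moreover have "(M_mat n \<delta> \<pi> *\<^sub>v y) $ i = act \<delta> \<pi> (($) y) i" by (rule M_mat_mult_vec[OF \<pi> assms])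
  ultimately show ?thesis by simp
qed

lemma Q_index:
  assumes "y \<in> carrier_vec (n + 1)" "i \<le> n"
  shows "(Q \<pi> *\<^sub>v y) $ i = cnj (a i) * act \<delta> \<pi> (($) y) i + y $ i"
proof -
  note M = M_mat_carrier[OF \<pi>, of \<delta>]
  note A' = mat_adjoint_carrier[OF A(1)]
  have My: "M_mat n \<delta> \<pi> *\<^sub>v y \<in> carrier_vec (n + 1)" using M assms by simp
  have "Q \<pi> *\<^sub>v y = (mat_adjoint A * M_mat n \<delta> \<pi>) *\<^sub>v y + 1\<^sub>m (n + 1) *\<^sub>v y"
    by (rule add_mult_distrib_mat_vec[OF mult_carrier_mat[OF A' M] one_carrier_mat assms(1)])
  also have "\<dots> = mat_adjoint A *\<^sub>v (M_mat n \<delta> \<pi> *\<^sub>v y) + y"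
    unfolding assoc_mult_mat_vec[OF A' M assms(1)] one_mult_mat_vec[OF assms(1)] ..
  finally have "(Q \<pi> *\<^sub>v y) $ i = (mat_adjoint A *\<^sub>v (M_mat n \<delta> \<pi> *\<^sub>v y)) $ i + y $ i"
    using assms by simp
  also have "(mat_adjoint A *\<^sub>v (M_mat n \<delta> \<pi> *\<^sub>v y)) $ i = cnj (a i) * (M_mat n \<delta> \<pi> *\<^sub>v y) $ i"
    unfolding adjoint_A_eq using assms by (intro mat_diag_mult_vec_index[OF My]) simp
  also have "(M_mat n \<delta> \<pi> *\<^sub>v y) $ i = act \<delta> \<pi> (($) y) i" by (rule M_mat_mult_vec[OF \<pi> assms])
  finally show ?thesis .
qed

lemma P_carrier: "P \<pi> \<in> carrier_mat (n + 1) (n + 1)"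
  using M_mat_carrier[OF \<pi>] A by simp

lemma Q_carrier: "Q \<pi> \<in> carrier_mat (n + 1) (n + 1)"
  by simp

text \<open>
  A kernel vector would satisfy \<open>y = - A\<^sup>* M y\<close>, but \<open>M\<close> preserves norms and \<open>A\<^sup>*\<close> strictly decreases
  those of nonzero vectors.
\<close>

lemma Q_inverse:
  "inv_mat (Q \<pi>) \<in> carrier_mat (n + 1) (n + 1)"
  "Q \<pi> * inv_mat (Q \<pi>) = 1\<^sub>m (n + 1)" "inv_mat (Q \<pi>) * Q \<pi> = 1\<^sub>m (n + 1)"
proof -
  have inj: "y = 0\<^sub>v (n + 1)" if y: "y \<in> carrier_vec (n + 1)" and Qy: "Q \<pi> *\<^sub>v y = 0\<^sub>v (n + 1)" for y
  proof -
    define z where "z = act \<delta> \<pi> (($) y)"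
    have yz: "y $ i = - cnj (a i) * z i" if "i \<le> n" for i
      using Q_index[OF y that] that unfolding Qy by (simp add: z_def add_eq_0_iff)
    have "(\<Sum>i\<le>n. z i * cnj (z i)) = (\<Sum>i\<le>n. y $ i * cnj (y $ i))"
      unfolding z_def by (rule sum_act[where \<delta> = \<delta>, OF \<pi> delta])
    then have "complex_of_real (\<Sum>i\<le>n. (cmod (z i))\<^sup>2) = complex_of_real (\<Sum>i\<le>n. (cmod (y $ i))\<^sup>2)"
      unfolding of_real_sum complex_norm_square .
    then have "(\<Sum>i\<le>n. (cmod (z i))\<^sup>2) = (\<Sum>i\<le>n. (cmod (y $ i))\<^sup>2)" using of_real_eq_iff by blast
    also have "\<dots> = (\<Sum>i\<le>n. (cmod (a i))\<^sup>2 * (cmod (z i))\<^sup>2)"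
      by (intro sum.cong refl) (simp add: yz norm_mult power_mult_distrib)
    finally have "(\<Sum>i\<le>n. (1 - (cmod (a i))\<^sup>2) * (cmod (z i))\<^sup>2) = 0"
      by (simp add: left_diff_distrib sum_subtractf)
    moreover have "0 < 1 - (cmod (a i))\<^sup>2" if "i \<le> n" for i using a_less[OF that] by (simp add: abs_square_less_1)
    ultimately have zero: "\<forall>i\<in>{..n}. (1 - (cmod (a i))\<^sup>2) * (cmod (z i))\<^sup>2 = 0"
      by (subst (asm) sum_nonneg_eq_0_iff) (auto simp: less_imp_le)
    have "z i = 0" if "i \<le> n" for i
      using bspec[OF zero, of i] that a_less[OF that] by (auto simp: abs_square_eq_1)
    then show ?thesis using y yz by (intro eq_vecI) auto
  qed
  show "inv_mat (Q \<pi>) \<in> carrier_mat (n + 1) (n + 1)"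
    "Q \<pi> * inv_mat (Q \<pi>) = 1\<^sub>m (n + 1)" "inv_mat (Q \<pi>) * Q \<pi> = 1\<^sub>m (n + 1)"
    using inv_mat_inverse[OF Q_carrier inj] by blast+
qed

abbreviation E :: "complex mat" where "E \<equiv> mat_diag (n + 1) (\<lambda>i. complex_of_real (e i))"

lemma E_inverse:
  "inv_mat E \<in> carrier_mat (n + 1) (n + 1)" "E * inv_mat E = 1\<^sub>m (n + 1)"
proof -
  have "v = 0\<^sub>v (n + 1)" if v: "v \<in> carrier_vec (n + 1)" and Ev: "E *\<^sub>v v = 0\<^sub>v (n + 1)" for v
  proof (rule eq_vecI)
    fix i assume "i < dim_vec (0\<^sub>v (n + 1) :: complex vec)"
    then have i: "i < n + 1" by simp
    have "complex_of_real (e i) * v $ i = 0" using mat_diag_mult_vec_index[OF v i, of "\<lambda>i. complex_of_real (e i)"] i unfolding Ev by simp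
    then show "v $ i = 0\<^sub>v (n + 1) $ i" using e_pos[of i] i by simp
  qed (use v in simp)
  then show "inv_mat E \<in> carrier_mat (n + 1) (n + 1)" "E * inv_mat E = 1\<^sub>m (n + 1)"
    using inv_mat_inverse[of E "n + 1"] by auto
qed

lemma R_mat_eq: "R_mat n \<delta> A \<pi> = inv_mat E * P \<pi> * inv_mat (Q \<pi>) * E"
  unfolding R_mat_def Let_def sqrt_defect ..

lemma R_carrier: "R_mat n \<delta> A \<pi> \<in> carrier_mat (n + 1) (n + 1)"
  unfolding R_mat_eq
  by (rule mult_carrier_mat[OF mult_carrier_mat[OF mult_carrier_mat[OF E_inverse(1) P_carrier] Q_inverse(1)] mat_diag_dim])

lemma R_mult_vec:
  assumes v: "v \<in> carrier_vec (n + 1)"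
  shows "E *\<^sub>v (R_mat n \<delta> A \<pi> *\<^sub>v v) = P \<pi> *\<^sub>v (inv_mat (Q \<pi>) *\<^sub>v (E *\<^sub>v v))"
proof -
  have Ec: "E \<in> carrier_mat (n + 1) (n + 1)" by simp
  note EP = mult_carrier_mat[OF E_inverse(1) P_carrier]
  note EPQ = mult_carrier_mat[OF EP Q_inverse(1)]
  have Ev: "E *\<^sub>v v \<in> carrier_vec (n + 1)" by (rule mult_mat_vec_carrier[OF Ec v])
  have QEv: "inv_mat (Q \<pi>) *\<^sub>v (E *\<^sub>v v) \<in> carrier_vec (n + 1)" by (rule mult_mat_vec_carrier[OF Q_inverse(1) Ev])
  have PQEv: "P \<pi> *\<^sub>v (inv_mat (Q \<pi>) *\<^sub>v (E *\<^sub>v v)) \<in> carrier_vec (n + 1)"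
    by (rule mult_mat_vec_carrier[OF P_carrier QEv])
  have "R_mat n \<delta> A \<pi> *\<^sub>v v = inv_mat E *\<^sub>v (P \<pi> *\<^sub>v (inv_mat (Q \<pi>) *\<^sub>v (E *\<^sub>v v)))"
    unfolding R_mat_eq assoc_mult_mat_vec[OF EPQ Ec v] assoc_mult_mat_vec[OF EP Q_inverse(1) Ev]
      assoc_mult_mat_vec[OF E_inverse(1) P_carrier QEv] ..
  then show ?thesis
    using assoc_mult_mat_vec[OF Ec E_inverse(1) PQEv] E_inverse(2) one_mult_mat_vec[OF PQEv] by simp
qed

text \<open>
  The relation between \<open>v\<close> and \<open>R v\<close>, parametrized by \<open>y = (A\<^sup>* M + I)\<^sup>-\<^sup>1 \<eta>\<^sub>A v\<close>. It is free of
  inverse matrices, so from here on coordinates suffice.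
\<close>

lemma Cayley_preimage:
  assumes v: "v \<in> carrier_vec (n + 1)"
  obtains y where "y \<in> carrier_vec (n + 1)"
    "\<And>i. i \<le> n \<Longrightarrow> complex_of_real (e i) * v $ i = cnj (a i) * act \<delta> \<pi> (($) y) i + y $ i"
    "\<And>i. i \<le> n \<Longrightarrow> complex_of_real (e i) * (R_mat n \<delta> A \<pi> *\<^sub>v v) $ i = a i * y $ i + act \<delta> \<pi> (($) y) i"
proof -
  define y where "y = inv_mat (Q \<pi>) *\<^sub>v (E *\<^sub>v v)"
  have Ev: "E *\<^sub>v v \<in> carrier_vec (n + 1)" by (rule mult_mat_vec_carrier[OF mat_diag_dim v])
  have y: "y \<in> carrier_vec (n + 1)" unfolding y_def by (rule mult_mat_vec_carrier[OF Q_inverse(1) Ev])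
  have Rv: "R_mat n \<delta> A \<pi> *\<^sub>v v \<in> carrier_vec (n + 1)" by (rule mult_mat_vec_carrier[OF R_carrier v])
  have Qy: "Q \<pi> *\<^sub>v y = E *\<^sub>v v"
    unfolding y_def assoc_mult_mat_vec[OF Q_carrier Q_inverse(1) Ev, symmetric] Q_inverse(2)
    by (rule one_mult_mat_vec[OF Ev])
  show thesis
  proof (rule that[OF y])
    fix i assume i: "i \<le> n"
    then have i': "i < n + 1" by simp
    show "complex_of_real (e i) * v $ i = cnj (a i) * act \<delta> \<pi> (($) y) i + y $ i"
      using mat_diag_mult_vec_index[OF v i', of "\<lambda>i. complex_of_real (e i)"] Q_index[OF y i]
      unfolding Qy by simp
    show "complex_of_real (e i) * (R_mat n \<delta> A \<pi> *\<^sub>v v) $ i = a i * y $ i + act \<delta> \<pi> (($) y) i"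
      using mat_diag_mult_vec_index[OF Rv i', of "\<lambda>i. complex_of_real (e i)"] P_index[OF y i]
      unfolding R_mult_vec[OF v] y_def by simp
  qed
qed

lemma Cayley_image:
  assumes v: "v \<in> carrier_vec (n + 1)" and y: "y \<in> carrier_vec (n + 1)" and i: "i \<le> n"
    and vy: "\<And>i. i \<le> n \<Longrightarrow> complex_of_real (e i) * v $ i = cnj (a i) * act \<delta> \<pi> (($) y) i + y $ i"
  shows "complex_of_real (e i) * (R_mat n \<delta> A \<pi> *\<^sub>v v) $ i = a i * y $ i + act \<delta> \<pi> (($) y) i"
proof -
  have i': "i < n + 1" using i by simp
  have Rv: "R_mat n \<delta> A \<pi> *\<^sub>v v \<in> carrier_vec (n + 1)" by (rule mult_mat_vec_carrier[OF R_carrier v])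
  have Qy: "E *\<^sub>v v = Q \<pi> *\<^sub>v y"
  proof (rule eq_vecI)
    fix l assume "l < dim_vec (Q \<pi> *\<^sub>v y)"
    then have l: "l < n + 1" by simp
    then have l': "l \<le> n" by simp
    show "(E *\<^sub>v v) $ l = (Q \<pi> *\<^sub>v y) $ l"
      unfolding mat_diag_mult_vec_index[OF v l] Q_index[OF y l'] by (rule vy[OF l'])
  qed (simp add: mat_diag_def)
  have "inv_mat (Q \<pi>) *\<^sub>v (E *\<^sub>v v) = y"
    unfolding Qy assoc_mult_mat_vec[OF Q_inverse(1) Q_carrier y, symmetric] Q_inverse(3)
    by (rule one_mult_mat_vec[OF y])
  then show ?thesis
    using mat_diag_mult_vec_index[OF Rv i', of "\<lambda>i. complex_of_real (e i)"] P_index[OF y i]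
    unfolding R_mult_vec[OF v] by simp
qed

text \<open>
  With \<open>z = M y\<close> the claim is, coordinate by coordinate, the polarized form of
  \<open>|a y + z|\<^sup>2 - |a\<^sup>* z + y|\<^sup>2 = (1 - |a|\<^sup>2) (|z|\<^sup>2 - |y|\<^sup>2)\<close>
  divided by \<open>1 - |a|\<^sup>2\<close>, and the right-hand side sums to zero because \<open>M\<close> is unitary.
\<close>

lemma R_isometry:
  assumes v: "v \<in> carrier_vec (n + 1)" and w: "w \<in> carrier_vec (n + 1)"
  shows "(R_mat n \<delta> A \<pi> *\<^sub>v v) \<bullet>c (R_mat n \<delta> A \<pi> *\<^sub>v w) = v \<bullet>c w"
proof -
  let ?R = "R_mat n \<delta> A \<pi>"
  obtain y where y: "y \<in> carrier_vec (n + 1)"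
    "\<And>i. i \<le> n \<Longrightarrow> complex_of_real (e i) * v $ i = cnj (a i) * act \<delta> \<pi> (($) y) i + y $ i"
    "\<And>i. i \<le> n \<Longrightarrow> complex_of_real (e i) * (?R *\<^sub>v v) $ i = a i * y $ i + act \<delta> \<pi> (($) y) i"
    using Cayley_preimage[OF v] by blast
  obtain x where x: "x \<in> carrier_vec (n + 1)"
    "\<And>i. i \<le> n \<Longrightarrow> complex_of_real (e i) * w $ i = cnj (a i) * act \<delta> \<pi> (($) x) i + x $ i"
    "\<And>i. i \<le> n \<Longrightarrow> complex_of_real (e i) * (?R *\<^sub>v w) $ i = a i * x $ i + act \<delta> \<pi> (($) x) i"
    using Cayley_preimage[OF w] by blast
  define z t where "z = act \<delta> \<pi> (($) y)" and "t = act \<delta> \<pi> (($) x)"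
  have summand: "(?R *\<^sub>v v) $ i * cnj ((?R *\<^sub>v w) $ i) - v $ i * cnj (w $ i)
      = z i * cnj (t i) - y $ i * cnj (x $ i)" if i: "i \<le> n" for i
  proof -
    define f where "f = complex_of_real (e i * e i)"
    have f0: "f \<noteq> 0" using e_pos[OF i] by (simp add: f_def)
    have "f * ((?R *\<^sub>v v) $ i * cnj ((?R *\<^sub>v w) $ i))
      = (complex_of_real (e i) * (?R *\<^sub>v v) $ i) * cnj (complex_of_real (e i) * (?R *\<^sub>v w) $ i)"
      by (simp add: f_def)
    also have "\<dots> = (a i * y $ i + z i) * cnj (a i * x $ i + t i)"
      unfolding y(3)[OF i] x(3)[OF i] z_def t_def ..
    finally have 1: "f * ((?R *\<^sub>v v) $ i * cnj ((?R *\<^sub>v w) $ i)) = (a i * y $ i + z i) * cnj (a i * x $ i + t i)" .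
    have "f * (v $ i * cnj (w $ i))
      = (complex_of_real (e i) * v $ i) * cnj (complex_of_real (e i) * w $ i)"
      by (simp add: f_def)
    also have "\<dots> = (cnj (a i) * z i + y $ i) * cnj (cnj (a i) * t i + x $ i)"
      unfolding y(2)[OF i] x(2)[OF i] z_def t_def ..
    finally have 2: "f * (v $ i * cnj (w $ i)) = (cnj (a i) * z i + y $ i) * cnj (cnj (a i) * t i + x $ i)" .
    have "f * ((?R *\<^sub>v v) $ i * cnj ((?R *\<^sub>v w) $ i) - v $ i * cnj (w $ i))
      = (1 - a i * cnj (a i)) * (z i * cnj (t i) - y $ i * cnj (x $ i))"
      unfolding right_diff_distrib 1 2 by (simp add: algebra_simps)
    also have "1 - a i * cnj (a i) = f" unfolding f_def e_square[OF i] ..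
    finally show ?thesis using f0 by simp
  qed
  have Rw: "?R *\<^sub>v w \<in> carrier_vec (n + 1)" by (rule mult_mat_vec_carrier[OF R_carrier w])
  have "(?R *\<^sub>v v) \<bullet>c (?R *\<^sub>v w) - v \<bullet>c w
      = (\<Sum>i\<le>n. (?R *\<^sub>v v) $ i * cnj ((?R *\<^sub>v w) $ i) - v $ i * cnj (w $ i))"
    unfolding cscalar_prod_sum[OF Rw] cscalar_prod_sum[OF w] sum_subtractf
    by (simp only: Suc_eq_plus1[symmetric] lessThan_Suc_atMost)
  also have "\<dots> = (\<Sum>i\<le>n. z i * cnj (t i) - y $ i * cnj (x $ i))"
    by (intro sum.cong refl summand) simp
  also have "\<dots> = 0"
    unfolding sum_subtractf z_def t_def using sum_act[where \<delta> = \<delta>, OF \<pi> delta, where y = "($) y" and y' = "($) x"] by simp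
  finally show ?thesis by simp
qed

end

section \<open>Eigenvectors of the transformed matrix\<close>

text \<open>
  The diagonal entries of \<open>D(\<mu>)\<close>: the disc automorphism taking \<open>a\<^sub>i\<close> to \<open>0\<close>, at the point \<open>\<mu>\<close>.
\<close>

definition mobius :: "complex \<Rightarrow> nat \<Rightarrow> complex" where
  "mobius \<mu> i = (\<mu> - a i) / (1 - cnj (a i) * \<mu>)"

lemma mobius_denom:
  assumes "cmod \<mu> = 1" "i \<le> n"
  shows "1 - cnj (a i) * \<mu> \<noteq> 0"
proof
  assume "1 - cnj (a i) * \<mu> = 0"
  then have "cmod (cnj (a i) * \<mu>) = 1" by (metis eq_iff_diff_eq_0 norm_one)
  then show False using assms a_less[of i] by (simp add: norm_mult)
qed

lemma norm_mobius:
  assumes "cmod \<mu> = 1" "i \<le> n"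
  shows "cmod (mobius \<mu> i) = 1"
proof -
  have "\<mu> * cnj \<mu> = 1" using assms(1) by (simp add: complex_norm_square[symmetric])
  then have "\<mu> * cnj (1 - cnj (a i) * \<mu>) = \<mu> - a i" by (simp add: algebra_simps)
  then have "cmod (\<mu> - a i) = cmod (1 - cnj (a i) * \<mu>)"
    using assms(1) by (metis norm_mult complex_mod_cnj mult_1)
  then show ?thesis using mobius_denom[OF assms] by (simp add: mobius_def norm_divide)
qed

text \<open>
  The diagonal matrix that maps solutions of \<open>M y = D(\<mu>) y\<close> to eigenvectors of \<open>R\<close> for \<open>\<mu>\<close>.
\<close>

definition weight :: "complex \<Rightarrow> nat \<Rightarrow> complex" where
  "weight \<mu> i = complex_of_real (e i) / (1 - cnj (a i) * \<mu>)"

lemma weight_nonzero: "cmod \<mu> = 1 \<Longrightarrow> i \<le> n \<Longrightarrow> weight \<mu> i \<noteq> 0"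
  using mobius_denom[of \<mu> i] e_pos[of i] by (simp add: weight_def)

lemma weight_mobius:
  assumes "cmod \<mu> = 1" "i \<le> n"
  shows "cnj (a i) * mobius \<mu> i + 1 = complex_of_real (e i) * weight \<mu> i"
    and "a i + mobius \<mu> i = \<mu> * (complex_of_real (e i) * weight \<mu> i)"
proof -
  define q where "q = 1 - cnj (a i) * \<mu>"
  have q: "q \<noteq> 0" using mobius_denom[OF assms] by (simp add: q_def)
  have ew: "complex_of_real (e i) * weight \<mu> i = (1 - a i * cnj (a i)) / q"
    using e_square[OF assms(2)] by (simp add: weight_def q_def)
  have mq: "mobius \<mu> i = (\<mu> - a i) / q" by (simp add: mobius_def q_def)
  have "cnj (a i) * mobius \<mu> i + 1 = (cnj (a i) * (\<mu> - a i) + q) / q"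
    unfolding mq using q by (simp add: add_divide_distrib)
  also have "cnj (a i) * (\<mu> - a i) + q = 1 - a i * cnj (a i)" by (simp add: q_def algebra_simps)
  finally show "cnj (a i) * mobius \<mu> i + 1 = complex_of_real (e i) * weight \<mu> i" unfolding ew .
  have "a i + mobius \<mu> i = (a i * q + (\<mu> - a i)) / q"
    unfolding mq using q by (simp add: add_divide_distrib)
  also have "a i * q + (\<mu> - a i) = \<mu> * (1 - a i * cnj (a i))" by (simp add: q_def algebra_simps)
  finally show "a i + mobius \<mu> i = \<mu> * (complex_of_real (e i) * weight \<mu> i)" unfolding ew by simp
qed

text \<open>
  The substitution that removes \<open>A\<close>: with \<open>z = M y\<close>, the equation \<open>R v = \<mu> v\<close> reads
  \<open>a y + z = \<mu> (a\<^sup>* z + y)\<close> in each coordinate, that is, \<open>z = D(\<mu>) y\<close>.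
\<close>

lemma eigenvector_untwist:
  assumes \<pi>: "set \<pi> \<subseteq> {1..n}" and \<mu>: "cmod \<mu> = 1"
    and v: "v \<in> carrier_vec (n + 1)" "R_mat n \<delta> A \<pi> *\<^sub>v v = \<mu> \<cdot>\<^sub>v v"
  obtains y where "\<And>i. i \<le> n \<Longrightarrow> act \<delta> \<pi> y i = mobius \<mu> i * y i"
    "\<And>i. i \<le> n \<Longrightarrow> v $ i = weight \<mu> i * y i"
proof -
  obtain u where u: "u \<in> carrier_vec (n + 1)"
    "\<And>i. i \<le> n \<Longrightarrow> complex_of_real (e i) * v $ i = cnj (a i) * act \<delta> \<pi> (($) u) i + u $ i"
    "\<And>i. i \<le> n \<Longrightarrow> complex_of_real (e i) * (R_mat n \<delta> A \<pi> *\<^sub>v v) $ i = a i * u $ i + act \<delta> \<pi> (($) u) i"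
    using Cayley_preimage[OF \<pi> v(1)] by blast
  have act: "act \<delta> \<pi> (($) u) i = mobius \<mu> i * u $ i" if i: "i \<le> n" for i
  proof -
    have "a i * u $ i + act \<delta> \<pi> (($) u) i = \<mu> * (complex_of_real (e i) * v $ i)"
      using u(3)[OF i] i v(1) unfolding v(2) by (simp add: mult.left_commute)
    also have "\<dots> = \<mu> * (cnj (a i) * act \<delta> \<pi> (($) u) i + u $ i)" unfolding u(2)[OF i] ..
    finally have "(1 - cnj (a i) * \<mu>) * act \<delta> \<pi> (($) u) i = (\<mu> - a i) * u $ i"
      by (simp add: algebra_simps)
    then show ?thesis using mobius_denom[OF \<mu> i] by (simp add: mobius_def field_simps)
  qed
  have "v $ i = weight \<mu> i * u $ i" if i: "i \<le> n" for i
  proof -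
    have "complex_of_real (e i) * v $ i = (cnj (a i) * mobius \<mu> i + 1) * u $ i"
      unfolding u(2)[OF i] act[OF i] by (simp add: distrib_right)
    also have "\<dots> = complex_of_real (e i) * (weight \<mu> i * u $ i)"
      unfolding weight_mobius(1)[OF \<mu> i] by simp
    finally show ?thesis using e_pos[OF i] by simp
  qed
  with act show thesis by (rule that)
qed

lemma eigenvector_profile:
  assumes \<pi>: "distinct \<pi>" "set \<pi> = {1..n}" and \<mu>: "cmod \<mu> = 1"
    and v: "v \<in> carrier_vec (n + 1)" "R_mat n \<delta> A \<pi> *\<^sub>v v = \<mu> \<cdot>\<^sub>v v" and i: "i \<le> n"
  shows "cmod (v $ i) = cmod (weight \<mu> i) * profile \<delta> (mobius \<mu>) i / cmod (weight \<mu> 0) * cmod (v $ 0)"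
proof -
  obtain y where y: "\<And>i. i \<le> n \<Longrightarrow> act \<delta> \<pi> y i = mobius \<mu> i * y i" "\<And>i. i \<le> n \<Longrightarrow> v $ i = weight \<mu> i * y i"
    using eigenvector_untwist[OF _ \<mu> v] \<pi>(2) by blast
  have "act \<delta> \<pi> y n = phase \<delta> (mobius \<mu>) n * y n \<and> (\<forall>i\<le>n. cmod (y i) = profile \<delta> (mobius \<mu>) i * cmod (y 0))"
    by (rule act_twisted_eigenvector[OF \<pi>]) (simp_all add: delta norm_mobius[OF \<mu>] y(1))
  then have "cmod (y i) = profile \<delta> (mobius \<mu>) i * cmod (y 0)" using i by blast
  then show ?thesis using y(2)[OF i] y(2)[of 0] weight_nonzero[OF \<mu>, of 0] by (simp add: norm_mult)
qed

text \<open>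
  For \<open>|\<mu>| = 1\<close>, the first \<open>n\<close> rows of \<open>M y = D(\<mu>) y\<close> have a nonzero solution, and \<open>M\<close>
  multiplies the last component of every such solution, which is not zero, by the phase. So the last
  row is the only restriction on \<open>\<mu>\<close>.
\<close>

lemma eigenvalue_iff_phase:
  assumes \<pi>: "distinct \<pi>" "set \<pi> = {1..n}"
  shows "eigenvalue (R_mat n \<delta> A \<pi>) \<mu> \<longleftrightarrow> cmod \<mu> = 1 \<and> phase \<delta> (mobius \<mu>) n = mobius \<mu> n"
proof -
  let ?R = "R_mat n \<delta> A \<pi>"
  have sub: "set \<pi> \<subseteq> {1..n}" using \<pi> by simp
  note R = R_carrier[OF sub]
  show ?thesis
  proof
    assume "eigenvalue ?R \<mu>"
    then obtain v where v: "v \<in> carrier_vec (n + 1)" "v \<noteq> 0\<^sub>v (n + 1)" "?R *\<^sub>v v = \<mu> \<cdot>\<^sub>v v"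
      using R unfolding eigenvalue_def eigenvector_def by auto
    have \<mu>: "cmod \<mu> = 1" using isometry_eigenvalue_unit[OF R_isometry[OF sub] v] .
    obtain y where y: "\<And>i. i \<le> n \<Longrightarrow> act \<delta> \<pi> y i = mobius \<mu> i * y i" "\<And>i. i \<le> n \<Longrightarrow> v $ i = weight \<mu> i * y i"
      using eigenvector_untwist[OF sub \<mu> v(1,3)] by blast
    have "act \<delta> \<pi> y n = phase \<delta> (mobius \<mu>) n * y n \<and> (\<forall>i\<le>n. cmod (y i) = profile \<delta> (mobius \<mu>) i * cmod (y 0))"
      by (rule act_twisted_eigenvector[OF \<pi>]) (simp_all add: delta norm_mobius[OF \<mu>] y(1))
    then have twisted: "act \<delta> \<pi> y n = phase \<delta> (mobius \<mu>) n * y n"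
      "\<forall>i\<le>n. cmod (y i) = profile \<delta> (mobius \<mu>) i * cmod (y 0)" by blast+
    have "y n \<noteq> 0"
    proof
      assume "y n = 0"
      moreover have "0 < profile \<delta> (mobius \<mu>) n"
        by (rule profile_pos[where \<delta> = \<delta>, OF delta norm_mobius[OF \<mu>]]) simp_all
      ultimately have "cmod (y 0) = 0" using twisted(2) by (metis less_irrefl mult_eq_0_iff norm_zero order_refl)
      then have "y i = 0" if "i \<le> n" for i using twisted(2) that by (metis mult_zero_right norm_eq_zero)
      then have "v = 0\<^sub>v (n + 1)" using v(1) y(2) by (intro eq_vecI) auto
      then show False using v(2) by simp
    qed
    then show "cmod \<mu> = 1 \<and> phase \<delta> (mobius \<mu>) n = mobius \<mu> n"
      using \<mu> y(1)[of n] twisted(1) by simp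
  next
    assume asm: "cmod \<mu> = 1 \<and> phase \<delta> (mobius \<mu>) n = mobius \<mu> n"
    then have \<mu>: "cmod \<mu> = 1" by simp
    obtain y where y0: "y 0 \<noteq> 0" and y: "\<And>i. i < n \<Longrightarrow> act \<delta> \<pi> y i = mobius \<mu> i * y i"
      using act_twisted_eigenvector_exists[where \<delta> = \<delta>, OF \<pi> delta, where d = "mobius \<mu>"] norm_mobius[OF \<mu>] by auto
    have "act \<delta> \<pi> y n = phase \<delta> (mobius \<mu>) n * y n \<and> (\<forall>i\<le>n. cmod (y i) = profile \<delta> (mobius \<mu>) i * cmod (y 0))"
      by (rule act_twisted_eigenvector[OF \<pi>]) (simp_all add: delta norm_mobius[OF \<mu>] y)
    then have "act \<delta> \<pi> y n = phase \<delta> (mobius \<mu>) n * y n" by blast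
    then have "act \<delta> \<pi> y n = mobius \<mu> n * y n" using asm by simp
    then have act: "act \<delta> \<pi> y i = mobius \<mu> i * y i" if "i \<le> n" for i
      using y[of i] that by (cases "i = n") auto
    define u v where "u = vec (n + 1) y" and "v = vec (n + 1) (\<lambda>i. weight \<mu> i * y i)"
    have u: "u \<in> carrier_vec (n + 1)" and v: "v \<in> carrier_vec (n + 1)" by (auto simp: u_def v_def)
    have act_u: "act \<delta> \<pi> (($) u) i = mobius \<mu> i * y i" if "i \<le> n" for i
    proof -
      have "act \<delta> \<pi> (($) u) i = act \<delta> \<pi> y i"
        by (rule act_cong_below[OF sub _ that]) (simp add: u_def)
      then show ?thesis using act[OF that] by simp
    qed
    have vu: "complex_of_real (e i) * v $ i = cnj (a i) * act \<delta> \<pi> (($) u) i + u $ i" if i: "i \<le> n" for i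
    proof -
      have "cnj (a i) * act \<delta> \<pi> (($) u) i + u $ i = (cnj (a i) * mobius \<mu> i + 1) * y i"
        unfolding act_u[OF i] using i by (simp add: u_def distrib_right)
      also have "\<dots> = complex_of_real (e i) * v $ i"
        unfolding weight_mobius(1)[OF \<mu> i] using i by (simp add: v_def)
      finally show ?thesis ..
    qed
    have "?R *\<^sub>v v = \<mu> \<cdot>\<^sub>v v"
    proof (rule eq_vecI)
      fix i assume "i < dim_vec (\<mu> \<cdot>\<^sub>v v)"
      then have i: "i \<le> n" using v by simp
      have "complex_of_real (e i) * (?R *\<^sub>v v) $ i = a i * u $ i + act \<delta> \<pi> (($) u) i"
        by (rule Cayley_image[OF sub v u i vu])
      also have "\<dots> = (a i + mobius \<mu> i) * y i"
        unfolding act_u[OF i] using i by (simp add: u_def distrib_right)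
      also have "\<dots> = complex_of_real (e i) * (\<mu> \<cdot>\<^sub>v v) $ i"
        unfolding weight_mobius(2)[OF \<mu> i] using i by (simp add: v_def)
      finally show "(?R *\<^sub>v v) $ i = (\<mu> \<cdot>\<^sub>v v) $ i" using e_pos[OF i] by simp
    qed (use R v in auto)
    moreover have "v $ 0 \<noteq> 0" using y0 weight_nonzero[OF \<mu>, of 0] by (simp add: v_def)
    then have "v \<noteq> 0\<^sub>v (n + 1)" by auto
    ultimately show "eigenvalue ?R \<mu>" using R v unfolding eigenvalue_def eigenvector_def by auto
  qed
qed

end

section \<open>Independence of the order of the factors\<close>

theorem theorem11p6:
  fixes n :: nat and \<delta> :: "nat \<Rightarrow> complex" and A :: "complex mat"
    and r :: "(complex \<times> complex) set"
  assumes "n \<ge> 1"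
    and "\<And>k. k \<in> {1..n} \<Longrightarrow> cmod (\<delta> k) < 1"
    and "A \<in> carrier_mat (n + 1) (n + 1)"
    and "diagonal_mat A"
    and "\<And>i. i < n + 1 \<Longrightarrow> cmod (A $$ (i, i)) < 1"
    and "linear_order r"
  shows "(\<forall>\<pi>\<in>permutations_of_set {1..n}.
            unitary_mat (n + 1) (R_mat n \<delta> A \<pi>) \<and>
            (\<exists>V \<Lambda>. eigenvalue_decomposition r (n + 1) (R_mat n \<delta> A \<pi>) V \<Lambda>)) \<and>
         (\<forall>\<pi>\<in>permutations_of_set {1..n}. \<forall>\<sigma>\<in>permutations_of_set {1..n}. \<forall>V \<Lambda> V' \<Lambda>'.
            eigenvalue_decomposition r (n + 1) (R_mat n \<delta> A \<pi>) V \<Lambda> \<longrightarrow>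
            eigenvalue_decomposition r (n + 1) (R_mat n \<delta> A \<sigma>) V' \<Lambda>' \<longrightarrow>
            \<Lambda> = \<Lambda>' \<and>
            (\<forall>i<n + 1. \<forall>j<n + 1. cmod (V $$ (i, j)) = cmod (V' $$ (i, j))))"
proof -
  interpret diagonal_cayley n \<delta> A using assms(2-5) by unfold_locales
  show ?thesis
  proof (intro conjI ballI allI impI)
    fix \<pi> assume "\<pi> \<in> permutations_of_set {1..n}"
    then have \<pi>: "set \<pi> \<subseteq> {1..n}" by (simp add: permutations_of_set_def)
    note iso = R_isometry[OF \<pi>]
    show "unitary_mat (n + 1) (R_mat n \<delta> A \<pi>)" by (rule unitary_mat_isometry[OF R_carrier[OF \<pi>] iso])
    show "\<exists>V \<Lambda>. eigenvalue_decomposition r (n + 1) (R_mat n \<delta> A \<pi>) V \<Lambda>"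
      by (rule isometry_eigenvalue_decomposition[OF assms(6) R_carrier[OF \<pi>] iso])
  next
    fix \<pi> \<sigma> V \<Lambda> V' \<Lambda>'
    assume "\<pi> \<in> permutations_of_set {1..n}" "\<sigma> \<in> permutations_of_set {1..n}"
    then have \<pi>: "distinct \<pi>" "set \<pi> = {1..n}" and \<sigma>: "distinct \<sigma>" "set \<sigma> = {1..n}"
      by (auto simp: permutations_of_set_def)
    assume dec: "eigenvalue_decomposition r (n + 1) (R_mat n \<delta> A \<pi>) V \<Lambda>"
      "eigenvalue_decomposition r (n + 1) (R_mat n \<delta> A \<sigma>) V' \<Lambda>'"
    define C where "C \<mu> i = cmod (weight \<mu> i) * profile \<delta> (mobius \<mu>) i / cmod (weight \<mu> 0)" for \<mu> i
    have C: "cmod (v $ i) = C \<mu> i * cmod (v $ 0)"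
      if "distinct \<tau>" "set \<tau> = {1..n}" "eigenvalue (R_mat n \<delta> A \<tau>) \<mu>"
        "v \<in> carrier_vec (n + 1)" "R_mat n \<delta> A \<tau> *\<^sub>v v = \<mu> \<cdot>\<^sub>v v" "i < n + 1" for \<tau> v \<mu> i
    proof -
      have "cmod \<mu> = 1" using that(3) unfolding eigenvalue_iff_phase[OF that(1,2)] by blast
      then show ?thesis unfolding C_def using that(6) by (intro eigenvector_profile[OF that(1,2) _ that(4,5)]) simp_all
    qed
    have spec: "eigenvalue (R_mat n \<delta> A \<pi>) \<mu> \<longleftrightarrow> eigenvalue (R_mat n \<delta> A \<sigma>) \<mu>" for \<mu>
      unfolding eigenvalue_iff_phase[OF \<pi>] eigenvalue_iff_phase[OF \<sigma>] ..
    have carr: "R_mat n \<delta> A \<pi> \<in> carrier_mat (n + 1) (n + 1)" "R_mat n \<delta> A \<sigma> \<in> carrier_mat (n + 1) (n + 1)"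
      using R_carrier \<pi> \<sigma> by auto
    note determined = eigenvalue_decomposition_determined[OF _ assms(6) carr dec C[OF \<pi>] C[OF \<sigma>] spec]
    show "\<Lambda> = \<Lambda>'" by (rule determined(1)) simp_all
    fix i j assume "i < n + 1" "j < n + 1"
    then show "cmod (V $$ (i, j)) = cmod (V' $$ (i, j))" using determined(2) by simp
  qed
qed

end
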